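(* Suppose that $\Gamma$ is a LEF group and $\Gamma\curvearrowright_{\alpha}X$ is a LEF action on the set $X$. If $R$ is a commutative unital ring with the property that $\operatorname{Aut}_R(R[Z])$ is a LEF group for every finite set $Z$, then $\mathcal{GL}(\Gamma,X,R)$ is a LEF group. In particular this holds if $R$ is an integral domain.
   Context: Linear enrichment. For a commutative unital ring $R$ and a set $X$, $R[X]$ is the free $R$-module with basis $X$ and $\operatorname{Aut}_R(R[X])$ its group of $R$-module automorphisms. $GL_f(X,R)\leq\operatorname{Aut}_R(R[X])$ is the subgroup of those $A$ for which there is a finite $Z_A\subseteq X$ such that $A$ preserves $R[Z_A]$ and fixes every basis vector $x\in X\setminus Z_A$. An action $\Gamma\curvearrowright_\alpha X$ induces an action (also denoted $\alpha$) on $R[X]$ by permuting basis elements, and $\hat\alpha(g):A\mapsto\alpha(g)A\alpha(g)^{-1}$ on $GL_f(X,R)$. Set $\mathcal{GL}(\Gamma,X,R)=GL_f(X,R)\rtimes_{\hat\alpha}\Gamma$. A group $\Gamma$ is LEF (locally embeddable into finite groups) if for every finite $A\subseteq\Gamma$ there are a finite group $Q$ and an injective function $\phi:A\to Q$ with $\phi(gh)=\phi(g)\phi(h)$ whenever $g,h,gh\in A$. An action $\Gamma\curvearrowright_\alpha X$ on a set is a LEF action if for all finite $F\subseteq\Gamma$ and $Z\subseteq X$ there exist a finite group $Q$, a finite set $Y$, an action $Q\curvearrowright_\beta Y$ and functions $\rho:\Gamma\to Q$, $\pi:Z\to Y$, with $\pi$ injective, such that (i) for all $g,h\in F$ with $gh\in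 F$, $\rho(gh)=\rho(g)\rho(h)$; (ii) if $g\in F$ and $x\in Z$ are such that $\alpha(g)\cdot x\in Z$, then $\pi(\alpha(g)\cdot x)=\beta(\rho(g))\cdot\pi(x)$. *)

theory Defs
  imports "HOL-Algebra.Algebra"
begin

section \<open>LEF groups and LEF actions\<close>

text \<open>
  The finite groups and the finite sets whose existence is asserted are taken with underlying set
  in \<^typ>\<open>nat\<close>. This is no restriction, since every finite group (set) is isomorphic
  to one of that form.
\<close>

definition LEF_group :: "('g, 'm) monoid_scheme \<Rightarrow> bool" where
  "LEF_group G \<longleftrightarrow> group G \<and>
    (\<forall>A. finite A \<and> A \<subseteq> carrier G \<longrightarrow>
      (\<exists>(Q :: nat monoid) \<phi>. group Q \<and> finite (carrier Q) \<and>
         \<phi> \<in> A \<rightarrow> carrier Q \<and> inj_on \<phi> A \<and>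
         (\<forall>g\<in>A. \<forall>h\<in>A. g \<otimes>\<^bsub>G\<^esub> h \<in> A \<longrightarrow> \<phi> (g \<otimes>\<^bsub>G\<^esub> h) = \<phi> g \<otimes>\<^bsub>Q\<^esub> \<phi> h)))"

definition LEF_action :: "('g, 'm) monoid_scheme \<Rightarrow> 'x set \<Rightarrow> ('g \<Rightarrow> 'x \<Rightarrow> 'x) \<Rightarrow> bool" where
  "LEF_action G S \<alpha> \<longleftrightarrow> group_action G S \<alpha> \<and>
    (\<forall>F Z. finite F \<and> F \<subseteq> carrier G \<and> finite Z \<and> Z \<subseteq> S \<longrightarrow>
      (\<exists>(Q :: nat monoid) (Y :: nat set) \<beta> \<rho> \<pi>.
         group Q \<and> finite (carrier Q) \<and> finite Y \<and> group_action Q Y \<beta> \<and>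
         \<rho> \<in> carrier G \<rightarrow> carrier Q \<and> \<pi> \<in> Z \<rightarrow> Y \<and> inj_on \<pi> Z \<and>
         (\<forall>g\<in>F. \<forall>h\<in>F. g \<otimes>\<^bsub>G\<^esub> h \<in> F \<longrightarrow> \<rho> (g \<otimes>\<^bsub>G\<^esub> h) = \<rho> g \<otimes>\<^bsub>Q\<^esub> \<rho> h) \<and>
         (\<forall>g\<in>F. \<forall>x\<in>Z. \<alpha> g x \<in> Z \<longrightarrow> \<pi> (\<alpha> g x) = \<beta> (\<rho> g) (\<pi> x))))"


section \<open>Free modules and their automorphism groups\<close>

text \<open>
  The elements of \<open>R[S]\<close> are the finitely supported functions, on the whole type, that vanish
  outside \<open>S\<close>; thus \<open>R[Z]\<close> is literally a subset of \<open>R[S]\<close> for \<open>Z \<subseteq> S\<close>. The fields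
  \<open>mult\<close> and \<open>one\<close> are present only because the record type of modules extends that of
  rings; they play no role.
\<close>

definition free_module :: "('r, 'm) ring_scheme \<Rightarrow> 'x set \<Rightarrow> ('r, 'x \<Rightarrow> 'r) module" where
  "free_module R S =
    \<lparr>carrier = {f. (\<forall>x. f x \<in> carrier R) \<and> (\<forall>x. x \<notin> S \<longrightarrow> f x = \<zero>\<^bsub>R\<^esub>) \<and>
                   finite {x. f x \<noteq> \<zero>\<^bsub>R\<^esub>}},
     monoid.mult = undefined,
     monoid.one = undefined,
     ring.zero = (\<lambda>x. \<zero>\<^bsub>R\<^esub>),
     ring.add = (\<lambda>f g x. f x \<oplus>\<^bsub>R\<^esub> g x),
     module.smult = (\<lambda>a f x. a \<otimes>\<^bsub>R\<^esub> f x)\<rparr>"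

definition basis_vec :: "('r, 'm) ring_scheme \<Rightarrow> 'x \<Rightarrow> 'x \<Rightarrow> 'r" where
  "basis_vec R x = (\<lambda>y. if y = x then \<one>\<^bsub>R\<^esub> else \<zero>\<^bsub>R\<^esub>)"

definition mod_hom ::
  "('r, 'm) ring_scheme \<Rightarrow> ('r, 'a, 'n) module_scheme \<Rightarrow> ('r, 'b, 'o) module_scheme \<Rightarrow> ('a \<Rightarrow> 'b) set"
  where
  "mod_hom R M N = {A \<in> carrier M \<rightarrow> carrier N.
     (\<forall>u\<in>carrier M. \<forall>v\<in>carrier M. A (u \<oplus>\<^bsub>M\<^esub> v) = A u \<oplus>\<^bsub>N\<^esub> A v) \<and>
     (\<forall>a\<in>carrier R. \<forall>u\<in>carrier M. A (a \<odot>\<^bsub>M\<^esub> u) = a \<odot>\<^bsub>N\<^esub> A u)}"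

definition mod_auto_group ::
  "('r, 'm) ring_scheme \<Rightarrow> ('r, 'a, 'n) module_scheme \<Rightarrow> ('a \<Rightarrow> 'a) monoid" where
  "mod_auto_group R M =
    BijGroup (carrier M) \<lparr>carrier := mod_hom R M M \<inter> Bij (carrier M)\<rparr>"

abbreviation Aut_free :: "('r, 'm) ring_scheme \<Rightarrow> 'x set \<Rightarrow> (('x \<Rightarrow> 'r) \<Rightarrow> ('x \<Rightarrow> 'r)) monoid" where
  "Aut_free R S \<equiv> mod_auto_group R (free_module R S)"


section \<open>The linear enrichment\<close>

definition GL_f :: "'x set \<Rightarrow> ('r, 'm) ring_scheme \<Rightarrow> (('x \<Rightarrow> 'r) \<Rightarrow> ('x \<Rightarrow> 'r)) monoid" where
  "GL_f S R = (Aut_free R S) \<lparr>carrier := {A \<in> carrier (Aut_free R S).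
     \<exists>Z. finite Z \<and> Z \<subseteq> S \<and>
       A ` carrier (free_module R Z) \<subseteq> carrier (free_module R Z) \<and>
       (\<forall>x\<in>S - Z. A (basis_vec R x) = basis_vec R x)}\<rparr>"

text \<open>
  The automorphism of \<open>R[S]\<close> that sends the basis vector \<open>x\<close> to the basis vector \<open>\<alpha> g x\<close>: the
  coefficient of \<open>x\<close> in the image of \<open>f\<close> is the coefficient of \<open>\<alpha> (inv g) x\<close> in \<open>f\<close>
  (see \<open>linear_action_basis_vec\<close> below).
\<close>

definition linear_action ::
  "('g, 'k) monoid_scheme \<Rightarrow> 'x set \<Rightarrow> ('r, 'm) ring_scheme \<Rightarrow> ('g \<Rightarrow> 'x \<Rightarrow> 'x) \<Rightarrow>
    'g \<Rightarrow> ('x \<Rightarrow> 'r) \<Rightarrow> ('x \<Rightarrow> 'r)" where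
  "linear_action G S R \<alpha> g =
    (\<lambda>f\<in>carrier (free_module R S). \<lambda>x. if x \<in> S then f (\<alpha> (inv\<^bsub>G\<^esub> g) x) else \<zero>\<^bsub>R\<^esub>)"

definition conj_action ::
  "('g, 'k) monoid_scheme \<Rightarrow> 'x set \<Rightarrow> ('r, 'm) ring_scheme \<Rightarrow> ('g \<Rightarrow> 'x \<Rightarrow> 'x) \<Rightarrow>
    'g \<Rightarrow> (('x \<Rightarrow> 'r) \<Rightarrow> ('x \<Rightarrow> 'r)) \<Rightarrow> (('x \<Rightarrow> 'r) \<Rightarrow> ('x \<Rightarrow> 'r))" where
  "conj_action G S R \<alpha> g = (\<lambda>A\<in>carrier (GL_f S R).
     linear_action G S R \<alpha> g \<otimes>\<^bsub>Aut_free R S\<^esub> A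
       \<otimes>\<^bsub>Aut_free R S\<^esub> inv\<^bsub>Aut_free R S\<^esub> (linear_action G S R \<alpha> g))"

definition semidirect_product ::
  "('n, 'k) monoid_scheme \<Rightarrow> ('h, 'm) monoid_scheme \<Rightarrow> ('h \<Rightarrow> 'n \<Rightarrow> 'n) \<Rightarrow> ('n \<times> 'h) monoid" where
  "semidirect_product N H \<theta> =
    \<lparr>carrier = carrier N \<times> carrier H,
     monoid.mult = (\<lambda>(n, h) (n', h'). (n \<otimes>\<^bsub>N\<^esub> \<theta> h n', h \<otimes>\<^bsub>H\<^esub> h')),
     monoid.one = (\<one>\<^bsub>N\<^esub>, \<one>\<^bsub>H\<^esub>)\<rparr>"

definition lin_enrichment ::
  "('g, 'k) monoid_scheme \<Rightarrow> 'x set \<Rightarrow> ('r, 'm) ring_scheme \<Rightarrow> ('g \<Rightarrow> 'x \<Rightarrow> 'x) \<Rightarrow>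
    ((('x \<Rightarrow> 'r) \<Rightarrow> ('x \<Rightarrow> 'r)) \<times> 'g) monoid" where
  "lin_enrichment G S R \<alpha> = semidirect_product (GL_f S R) G (conj_action G S R \<alpha>)"


section \<open>Basic properties of the construction\<close>

lemma basis_vec_in_free_module:
  assumes "cring R" "x \<in> S"
  shows "basis_vec R x \<in> carrier (free_module R S)"
proof -
  interpret cring R by fact
  have "finite {y. basis_vec R x y \<noteq> \<zero>\<^bsub>R\<^esub>}"
    by (rule finite_subset[of _ "{x}"]) (auto simp: basis_vec_def)
  then show ?thesis using assms(2) by (auto simp: free_module_def basis_vec_def)
qed

lemma module_free_module:
  assumes "cring R"
  shows "module R (free_module R S)"
proof -
  interpret cring R by fact
  show ?thesis
  proof (rule moduleI)
    show "cring R" by fact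
    show "abelian_group (free_module R S)"
    proof (rule abelian_groupI)
      fix f assume f: "f \<in> carrier (free_module R S)"
      let ?g = "\<lambda>x. \<ominus>\<^bsub>R\<^esub> f x"
      have "finite {x. ?g x \<noteq> \<zero>\<^bsub>R\<^esub>}"
        by (rule finite_subset[of _ "{x. f x \<noteq> \<zero>\<^bsub>R\<^esub>}"]) (use f in \<open>auto simp: free_module_def\<close>)
      then have "?g \<in> carrier (free_module R S)"
        using f by (auto simp: free_module_def)
      moreover have "?g \<oplus>\<^bsub>free_module R S\<^esub> f = \<zero>\<^bsub>free_module R S\<^esub>"
        using f by (auto simp: free_module_def l_neg)
      ultimately show "\<exists>g\<in>carrier (free_module R S).
          g \<oplus>\<^bsub>free_module R S\<^esub> f = \<zero>\<^bsub>free_module R S\<^esub>" by blast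
    next
      fix f g assume fg: "f \<in> carrier (free_module R S)" "g \<in> carrier (free_module R S)"
      have "finite {x. f x \<oplus>\<^bsub>R\<^esub> g x \<noteq> \<zero>\<^bsub>R\<^esub>}"
        by (rule finite_subset[of _ "{x. f x \<noteq> \<zero>\<^bsub>R\<^esub>} \<union> {x. g x \<noteq> \<zero>\<^bsub>R\<^esub>}"])
          (use fg in \<open>auto simp: free_module_def\<close>)
      then show "f \<oplus>\<^bsub>free_module R S\<^esub> g \<in> carrier (free_module R S)"
        using fg by (auto simp: free_module_def)
    qed (auto simp: free_module_def a_ac)
  next
    fix a f assume af: "a \<in> carrier R" "f \<in> carrier (free_module R S)"
    have "finite {x. a \<otimes>\<^bsub>R\<^esub> f x \<noteq> \<zero>\<^bsub>R\<^esub>}"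
      by (rule finite_subset[of _ "{x. f x \<noteq> \<zero>\<^bsub>R\<^esub>}"]) (use af in \<open>auto simp: free_module_def\<close>)
    then show "a \<odot>\<^bsub>free_module R S\<^esub> f \<in> carrier (free_module R S)"
      using af by (auto simp: free_module_def)
  qed (auto simp: free_module_def l_distr r_distr m_assoc)
qed

lemma linear_action_basis_vec:
  assumes "cring R" "group_action G S \<alpha>" "g \<in> carrier G" "x \<in> S"
  shows "linear_action G S R \<alpha> g (basis_vec R x) = basis_vec R (\<alpha> g x)"
proof
  fix y
  interpret group_action G S \<alpha> by fact
  have G: "group G" using group_hom by (simp add: group_hom_def)
  have gx: "\<alpha> g x \<in> S" using assms element_image by blast
  have "\<alpha> (inv\<^bsub>G\<^esub> g) y = x \<longleftrightarrow> y = \<alpha> g x" if "y \<in> S"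
    using that assms orbit_sym_aux G group.inv_closed group.inv_inv by metis
  then show "linear_action G S R \<alpha> g (basis_vec R x) y = basis_vec R (\<alpha> g x) y"
    using basis_vec_in_free_module[OF assms(1,4)] gx
    by (auto simp: linear_action_def basis_vec_def)
qed

end

theory Submission
  imports Defs "HOL-Number_Theory.Residues"
begin

text \<open>
  The map sending \<open>(A, g)\<close> to \<open>(A \<circ> \<alpha> g, g)\<close> embeds the linear enrichment into
  \<open>Aut(R[S]) \<times> \<Gamma>\<close>. Given a finite set of elements \<open>(A, g)\<close>, choose a finite \<open>Z\<close> that contains the
  supports of all the \<open>A\<close> and their translates by all the \<open>g\<close>, and let \<open>\<rho>\<close> and \<open>\<pi> : Z \<rightarrow> Y\<close> witness
  that the action is LEF. An automorphism supported on \<open>Z\<close> can be moved along \<open>\<pi>\<close> to an automorphism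
  \<open>T A\<close> of \<open>R[Y]\<close>, and \<open>T\<close> turns conjugation by \<open>\<alpha> g\<close> into conjugation by the permutation matrix
  of \<open>\<rho> g\<close>. So \<open>(A, g) \<mapsto> (T A \<circ> \<beta> (\<rho> g), g)\<close> is a local embedding into \<open>Aut(R[Y]) \<times> \<Gamma>\<close>, a product of
  two LEF groups.

  If \<open>R\<close> is a domain, the entries of finitely many matrices and of their inverses lie in a finitely
  generated subring \<open>D\<close>, and it suffices to find a homomorphism from \<open>D\<close> to a finite ring that is
  injective on these entries. By induction on the number of generators, every nonzero \<open>d \<in> D\<close> becomes
  a unit under some homomorphism to a nonzero finite commutative ring; apply this to a common multiple
  of the differences of the entries.
\<close>

section \<open>Homomorphisms to finite rings\<close>

text \<open>The factor in \<Gamma> cannot be dropped: if \<Gamma> acts trivially, the operator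
  \<open>A\<close> composed with \<open>\<alpha> g\<close> forgets \<open>g\<close>. Nor does the
  witness of the LEF action help here, since \<open>\<rho>\<close> need not be injective; the finite
  group that separates the \<open>g\<close> is chosen independently of it. A permutation operator
  \<open>\<alpha> g\<close> may move infinitely many basis vectors, so the composite has in general
  no finite support and cannot be moved along \<open>\<pi>\<close> as a whole. Only \<open>A\<close>
  is transported, and \<open>\<alpha> g\<close> is replaced by the permutation given by
  \<open>\<rho> g\<close>. Multiplying two pairs conjugates the second operator, which moves its
  support by \<open>g\<close>; this is why translates of supports are needed. For a domain, the
  detour through a subring is forced: a field such as the rationals has no homomorphism to a nonzero
  finite ring. Entries of inverse matrices are included because an invertible matrix over R may fail
  to be invertible over the subring generated by its own entries.\<close>

lemma finite_group_nat_copy: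
  assumes "group G" "finite (carrier G)"
  obtains Q :: "nat monoid" and f where "group Q" "finite (carrier Q)" "f \<in> iso G Q"
proof -
  interpret group G by fact
  obtain f where f: "bij_betw f (carrier G) {0..<card (carrier G)}"
    using assms(2) ex_bij_betw_finite_nat by blast
  let ?j = "inv_into (carrier G) f"
  define Q :: "nat monoid" where "Q = \<lparr>carrier = f ` carrier G, monoid.mult = \<lambda>x y. f (?j x \<otimes>\<^bsub>G\<^esub> ?j y),
    one = f \<one>\<^bsub>G\<^esub>\<rparr>"
  have inj: "inj_on f (carrier G)" using f by (simp add: bij_betw_def)
  have iso: "f \<in> iso G Q"
    using inj by (auto simp: iso_def hom_def bij_betw_def Q_def)
  \<comment> \<open>The library's transfer of a group structure along an isomorphism overwrites the
    unit of the target; here this changes nothing.\<close>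
  have "Q \<lparr>one := f \<one>\<^bsub>G\<^esub>\<rparr> = Q" by (simp add: Q_def)
  then have "group Q" using iso_imp_img_group[OF iso] by simp
  moreover have "finite (carrier Q)" using assms(2) by (simp add: Q_def)
  ultimately show ?thesis using iso that by blast
qed

lemma finite_cring_nat_copy:
  assumes "cring K" "finite (carrier K)"
  obtains L :: "nat ring" and f where "cring L" "finite (carrier L)" "f \<in> ring_iso K L"
proof -
  interpret cring K by fact
  obtain f where f: "bij_betw f (carrier K) {0..<card (carrier K)}"
    using assms(2) ex_bij_betw_finite_nat by blast
  let ?j = "inv_into (carrier K) f"
  define L :: "nat ring" where "L = \<lparr>carrier = f ` carrier K, monoid.mult = \<lambda>x y. f (?j x \<otimes>\<^bsub>K\<^esub> ?j y),
    monoid.one = f \<one>\<^bsub>K\<^esub>, ring.zero = f \<zero>\<^bsub>K\<^esub>, ring.add = \<lambda>x y. f (?j x \<oplus>\<^bsub>K\<^esub> ?j y)\<rparr>"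
  have inj: "inj_on f (carrier K)" using f by (simp add: bij_betw_def)
  have iso: "f \<in> ring_iso K L"
    using inj by (intro ring_iso_memI) (auto simp: bij_betw_def L_def)
  have "L \<lparr>zero := f \<zero>\<^bsub>K\<^esub>\<rparr> = L" by (simp add: L_def)
  then have "cring L" using ring_iso_imp_img_cring[OF iso] by simp
  moreover have "finite (carrier L)" using assms(2) by (simp add: L_def)
  ultimately show ?thesis using iso that by blast
qed

text \<open>The first isomorphism theorem in the form needed for adjoining one element: a
  homomorphism out of A[X] descends to B = A[x] once it kills all relations satisfied by x. Choosing
  preimages by \<open>inv_into\<close> avoids forming the quotient.\<close>

lemma ring_hom_factor:
  assumes "ring P" "ring B" "ring K" "e \<in> ring_hom P B" "e ` carrier P = carrier B"
    and "g \<in> ring_hom P K" "\<And>p. p \<in> carrier P \<Longrightarrow> e p = \<zero>\<^bsub>B\<^esub> \<Longrightarrow> g p = \<zero>\<^bsub>K\<^esub>"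
  obtains h where "h \<in> ring_hom B K" "\<And>p. p \<in> carrier P \<Longrightarrow> h (e p) = g p"
proof -
  interpret e: ring_hom_ring P B e using assms by (intro ring_hom_ringI2)
  interpret g: ring_hom_ring P K g using assms by (intro ring_hom_ringI2)
  have eq: "g p = g q" if "p \<in> carrier P" "q \<in> carrier P" "e p = e q" for p q
  proof -
    have "e (p \<ominus>\<^bsub>P\<^esub> q) = \<zero>\<^bsub>B\<^esub>" using that by (simp add: a_minus_def e.S.r_neg)
    then have "g p \<ominus>\<^bsub>K\<^esub> g q = \<zero>\<^bsub>K\<^esub>" using assms(7)[of "p \<ominus>\<^bsub>P\<^esub> q"] that by (simp add: a_minus_def)
    then show ?thesis using that by (simp add: g.S.r_right_minus_eq)
  qed
  define h where "h = (\<lambda>b. g (inv_into (carrier P) e b))"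
  have h: "h (e p) = g p" if "p \<in> carrier P" for p
    unfolding h_def using that by (intro eq) (auto intro: inv_into_into f_inv_into_f)
  have "h \<in> ring_hom B K"
  proof (rule ring_hom_memI)
    show "h x \<in> carrier K" if "x \<in> carrier B" for x
      using that h assms(5) by (metis g.hom_closed imageE)
    show "h \<one>\<^bsub>B\<^esub> = \<one>\<^bsub>K\<^esub>" using h[of "\<one>\<^bsub>P\<^esub>"] by simp
    fix x y assume "x \<in> carrier B" "y \<in> carrier B"
    then obtain p q where "p \<in> carrier P" "q \<in> carrier P" "x = e p" "y = e q"
      using assms(5) by (metis imageE)
    then show "h (x \<otimes>\<^bsub>B\<^esub> y) = h x \<otimes>\<^bsub>K\<^esub> h y" "h (x \<oplus>\<^bsub>B\<^esub> y) = h x \<oplus>\<^bsub>K\<^esub> h y"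
      using h[of "p \<otimes>\<^bsub>P\<^esub> q"] h[of "p \<oplus>\<^bsub>P\<^esub> q"] by (simp_all add: h)
  qed
  with h that show ?thesis by blast
qed

lemma ring_hom_Units:
  assumes "monoid A" "\<phi> \<in> ring_hom A K" "u \<in> Units A"
  shows "\<phi> u \<in> Units K"
proof -
  obtain v where v: "u \<in> carrier A" "v \<in> carrier A" "u \<otimes>\<^bsub>A\<^esub> v = \<one>\<^bsub>A\<^esub>" "v \<otimes>\<^bsub>A\<^esub> u = \<one>\<^bsub>A\<^esub>"
    using assms(3) by (auto simp: Units_def)
  have "\<phi> u \<otimes>\<^bsub>K\<^esub> \<phi> v = \<one>\<^bsub>K\<^esub>" "\<phi> v \<otimes>\<^bsub>K\<^esub> \<phi> u = \<one>\<^bsub>K\<^esub>"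
    using v ring_hom_memE(2,4)[OF assms(2)] by metis+
  then show ?thesis
    using ring_hom_memE(1)[OF assms(2)] v unfolding Units_def by blast
qed

lemma (in cring) Units_of_mult_unit:
  assumes "a \<in> carrier R" "b \<in> carrier R" "a \<otimes> b \<in> Units R"
  shows "a \<in> Units R"
  using unit_factor[OF assms(3)] assms by simp

section \<open>Polynomial rings modulo a polynomial with invertible leading coefficient\<close>

lemma ring_hom_UP:
  assumes "cring A" "cring K" "\<phi> \<in> ring_hom A K"
  shows "(\<lambda>p n. \<phi> (p n)) \<in> ring_hom (UP A) (UP K)"
proof -
  interpret h: ring_hom_cring A K \<phi> using assms by (intro ring_hom_cringI)
  have up: "(\<lambda>n. \<phi> (p n)) \<in> up K" if p: "p \<in> up A" for p
  proof
    obtain n where n: "bound \<zero>\<^bsub>A\<^esub> n p" using p by auto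
    have "bound \<zero>\<^bsub>K\<^esub> n (\<lambda>n. \<phi> (p n))"
      by (rule bound.intro) (simp add: bound.bound[OF n])
    then show "\<exists>n. bound \<zero>\<^bsub>K\<^esub> n (\<lambda>n. \<phi> (p n))" ..
  qed (use p in \<open>auto intro: h.hom_closed mem_upD\<close>)
  show ?thesis
  proof (rule ring_hom_memI)
    fix p assume "p \<in> carrier (UP A)"
    then show "(\<lambda>n. \<phi> (p n)) \<in> carrier (UP K)" using up by (simp add: UP_def)
  next
    fix p q assume "p \<in> carrier (UP A)" "q \<in> carrier (UP A)"
    then have pq: "p \<in> up A" "q \<in> up A" by (auto simp: UP_def)
    show "(\<lambda>n. \<phi> ((p \<otimes>\<^bsub>UP A\<^esub> q) n)) = (\<lambda>n. \<phi> (p n)) \<otimes>\<^bsub>UP K\<^esub> (\<lambda>n. \<phi> (q n))"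
    proof
      fix n
      have "\<phi> (\<Oplus>\<^bsub>A\<^esub>i\<in>{..n}. p i \<otimes>\<^bsub>A\<^esub> q (n - i)) = (\<Oplus>\<^bsub>K\<^esub>i\<in>{..n}. \<phi> (p i \<otimes>\<^bsub>A\<^esub> q (n - i)))"
        using pq by (subst h.hom_finsum) (auto simp: comp_def mem_upD)
      also have "\<dots> = (\<Oplus>\<^bsub>K\<^esub>i\<in>{..n}. \<phi> (p i) \<otimes>\<^bsub>K\<^esub> \<phi> (q (n - i)))"
        using pq by (intro h.S.finsum_cong') (auto simp: mem_upD)
      finally show "\<phi> ((p \<otimes>\<^bsub>UP A\<^esub> q) n) = ((\<lambda>n. \<phi> (p n)) \<otimes>\<^bsub>UP K\<^esub> (\<lambda>n. \<phi> (q n))) n"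
        using pq up by (simp add: UP_def)
    qed
    show "(\<lambda>n. \<phi> ((p \<oplus>\<^bsub>UP A\<^esub> q) n)) = (\<lambda>n. \<phi> (p n)) \<oplus>\<^bsub>UP K\<^esub> (\<lambda>n. \<phi> (q n))"
      using pq up by (simp add: UP_def mem_upD)
  next
    show "(\<lambda>n. \<phi> (\<one>\<^bsub>UP A\<^esub> n)) = \<one>\<^bsub>UP K\<^esub>" by (simp add: UP_def fun_eq_iff)
  qed
qed

text \<open>\<open>UP\<close> represents a polynomial by its coefficient function, so
  \<open>coeff\<close> is evaluation. This links maps defined coefficient by coefficient to library
  facts stated with \<open>coeff\<close>.\<close>

lemma coeff_UP_eta: "p \<in> carrier (UP R) \<Longrightarrow> up_ring.coeff (UP R) p = p"
  by (simp add: UP_def)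

context UP_cring
begin

lemma deg_eq_of_coeffs:
  assumes "p \<in> carrier P" "\<And>n. m < n \<Longrightarrow> up_ring.coeff P p n = \<zero>" "up_ring.coeff P p m \<noteq> \<zero>"
  shows "deg R p = m"
  using assms by (intro le_antisym deg_aboveI deg_belowI)

text \<open>Over a ring with zero divisors the degree of a product may drop, so only the coefficient
  at the sum of the degrees is controlled: for any other index i one of the two factors lies above
  its degree.\<close>

lemma coeff_mult_deg_sum:
  assumes p: "p \<in> carrier P" and q: "q \<in> carrier P"
  shows "up_ring.coeff P (p \<otimes>\<^bsub>P\<^esub> q) (deg R p + deg R q) = lcoeff p \<otimes> lcoeff q"
proof -
  let ?s = "\<lambda>i. up_ring.coeff P p i \<otimes> up_ring.coeff P q (deg R p + deg R q - i)"
  have "up_ring.coeff P (p \<otimes>\<^bsub>P\<^esub> q) (deg R p + deg R q) = (\<Oplus>i\<in>{..deg R p + deg R q}. ?s i)"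
    using p q by simp
  also have "\<dots> = (\<Oplus>i\<in>{..deg R p + deg R q}. if deg R p = i then lcoeff p \<otimes> lcoeff q else \<zero>)"
  proof (intro R.finsum_cong' refl)
    fix i
    consider "i < deg R p" | "i = deg R p" | "deg R p < i" by linarith
    then show "?s i = (if deg R p = i then lcoeff p \<otimes> lcoeff q else \<zero>)"
      by cases (use p q in \<open>auto simp: deg_aboveD\<close>)
  qed (use p q in auto)
  also have "\<dots> = lcoeff p \<otimes> lcoeff q"
    using p q R.finsum_singleton[of "deg R p" "{..deg R p + deg R q}" "\<lambda>_. lcoeff p \<otimes> lcoeff q"] by auto
  finally show ?thesis .
qed

text \<open>Pseudo-division by \<open>h\<close> multiplies the dividend by a power of the leading
  coefficient of \<open>h\<close>. That power is invertible, so every coset has a representative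
  with coefficients only below \<open>deg R h\<close>, and over a finite ring there are finitely
  many of these.\<close>

lemma finite_quotient_unit_lcoeff:
  assumes "finite (carrier R)" "h \<in> carrier P" "lcoeff h \<in> Units R" "\<one> \<noteq> \<zero>"
  shows "finite (carrier (P Quot PIdl\<^bsub>P\<^esub> h))"
proof -
  interpret I: ideal "PIdl\<^bsub>P\<^esub> h" P using assms(2) by (rule P.cgenideal_ideal)
  let ?S = "{r. \<forall>n. (n \<in> {..<deg R h} \<longrightarrow> r n \<in> carrier R) \<and> (n \<notin> {..<deg R h} \<longrightarrow> r n = \<zero>)}"
  have h0: "h \<noteq> \<zero>\<^bsub>P\<^esub>"
  proof
    assume "h = \<zero>\<^bsub>P\<^esub>"
    then have "\<zero> \<in> Units R" using assms(3) by simp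
    then show False using assms(4) R.Units_r_inv[of \<zero>] R.l_null R.Units_inv_closed by metis
  qed
  have "carrier (P Quot PIdl\<^bsub>P\<^esub> h) \<subseteq> (\<lambda>r. PIdl\<^bsub>P\<^esub> h +>\<^bsub>P\<^esub> r) ` ?S"
  proof
    fix C assume "C \<in> carrier (P Quot PIdl\<^bsub>P\<^esub> h)"
    then obtain p where p: "p \<in> carrier P" "C = PIdl\<^bsub>P\<^esub> h +>\<^bsub>P\<^esub> p"
      by (auto simp: FactRing_def A_RCOSETS_def')
    obtain q r k where qr: "q \<in> carrier P" "r \<in> carrier P" "r = \<zero>\<^bsub>P\<^esub> \<or> deg R r < deg R h"
      and eq: "lcoeff h [^] (k::nat) \<odot>\<^bsub>P\<^esub> p = h \<otimes>\<^bsub>P\<^esub> q \<oplus>\<^bsub>P\<^esub> r"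
      using long_div_theorem[OF assms(2) p(1) h0] by blast
    let ?u = "lcoeff h [^] k"
    have u: "?u \<in> Units R" using assms(3) by (rule R.Units_pow_closed)
    let ?v = "inv ?u"
    have v: "?v \<in> carrier R" "?v \<otimes> ?u = \<one>" using u by auto
    have uc: "?u \<in> carrier R" using u by auto
    have "p = ?v \<odot>\<^bsub>P\<^esub> (?u \<odot>\<^bsub>P\<^esub> p)"
      using p v uc by (simp add: UP_smult_assoc1[symmetric])
    also have "\<dots> = (?v \<odot>\<^bsub>P\<^esub> q) \<otimes>\<^bsub>P\<^esub> h \<oplus>\<^bsub>P\<^esub> ?v \<odot>\<^bsub>P\<^esub> r"
      unfolding eq using v qr assms(2) by (simp add: UP_smult_r_distr UP_smult_assoc2 P.m_comm[of h])
    finally have "p \<ominus>\<^bsub>P\<^esub> ?v \<odot>\<^bsub>P\<^esub> r = (?v \<odot>\<^bsub>P\<^esub> q) \<otimes>\<^bsub>P\<^esub> h"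
      using v qr assms(2) by (simp add: a_minus_def P.a_assoc P.r_neg)
    then have "p \<ominus>\<^bsub>P\<^esub> ?v \<odot>\<^bsub>P\<^esub> r \<in> PIdl\<^bsub>P\<^esub> h"
      using v qr unfolding cgenideal_def by auto
    then have "C = PIdl\<^bsub>P\<^esub> h +>\<^bsub>P\<^esub> (?v \<odot>\<^bsub>P\<^esub> r)"
      using p v qr P.quotient_eq_iff_same_a_r_cos[OF I.is_ideal, of p] by auto
    moreover have "?v \<odot>\<^bsub>P\<^esub> r \<in> ?S"
    proof -
      define w where "w = ?v \<odot>\<^bsub>P\<^esub> r"
      have w: "w \<in> carrier P" using v qr by (simp add: w_def)
      have eta: "up_ring.coeff P w = w" using coeff_UP_eta[of w R, folded P_def] w by simp
      have "w n = \<zero>" if "\<not> n < deg R h" for n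
      proof -
        have "up_ring.coeff P w n = \<zero>" using qr v that by (auto simp: deg_aboveD w_def)
        then show ?thesis by (simp add: eta)
      qed
      moreover have "w n \<in> carrier R" for n using coeff_closed[OF w, of n] by (simp add: eta)
      ultimately show ?thesis by (simp add: w_def)
    qed
    ultimately show "C \<in> (\<lambda>r. PIdl\<^bsub>P\<^esub> h +>\<^bsub>P\<^esub> r) ` ?S" by blast
  qed
  moreover have "finite ?S" using assms(1) by (intro finite_set_of_finite_funs) auto
  ultimately show ?thesis by (meson finite_imageI finite_subset)
qed

text \<open>A unit leading coefficient replaces the absence of zero divisors: if 1 = q h, the
  coefficient at deg q + deg h > 0 vanishes, and cancelling the unit kills the leading coefficient
  of q, so q = 0 and 1 = 0.\<close>

lemma one_notin_PIdl_unit_lcoeff: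
  assumes "h \<in> carrier P" "lcoeff h \<in> Units R" "\<one> \<noteq> \<zero>" "deg R h > 0"
  shows "\<one>\<^bsub>P\<^esub> \<notin> PIdl\<^bsub>P\<^esub> h"
proof
  assume "\<one>\<^bsub>P\<^esub> \<in> PIdl\<^bsub>P\<^esub> h"
  then obtain q where q: "q \<in> carrier P" "\<one>\<^bsub>P\<^esub> = q \<otimes>\<^bsub>P\<^esub> h" unfolding cgenideal_def by auto
  have "lcoeff q \<otimes> lcoeff h = up_ring.coeff P \<one>\<^bsub>P\<^esub> (deg R q + deg R h)"
    using coeff_mult_deg_sum[OF q(1) assms(1)] q(2) by simp
  then have "lcoeff q \<otimes> lcoeff h = \<zero>" using assms(4) by simp
  then have "lcoeff q \<otimes> lcoeff h \<otimes> inv (lcoeff h) = \<zero>" using assms(2) by simp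
  then have "lcoeff q = \<zero>" using assms q by (simp add: R.m_assoc)
  then have "q = \<zero>\<^bsub>P\<^esub>" using lcoeff_nonzero2[OF q(1)] by blast
  then have "\<one>\<^bsub>P\<^esub> = \<zero>\<^bsub>P\<^esub>" using q(2) assms(1) by simp
  then have "up_ring.coeff P \<one>\<^bsub>P\<^esub> 0 = up_ring.coeff P \<zero>\<^bsub>P\<^esub> 0" by simp
  then show False using assms(3) by simp
qed

end

text \<open>
  Asking for \<open>\<phi> c\<close> to be a unit, and not just nonzero, is what makes the induction on generators work:
  \<open>K\<close> need not be a domain, and a leading coefficient has to stay invertible for the quotient of
  \<open>K[X]\<close> to be finite and nonzero.
\<close>

definition unit_specializable :: "('a, 'm) ring_scheme \<Rightarrow> bool" where
  "unit_specializable A \<longleftrightarrow> (\<forall>c\<in>carrier A. c \<noteq> \<zero>\<^bsub>A\<^esub> \<longrightarrow>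
     (\<exists>(K :: nat ring) \<phi>. cring K \<and> finite (carrier K) \<and> \<one>\<^bsub>K\<^esub> \<noteq> \<zero>\<^bsub>K\<^esub> \<and>
        \<phi> \<in> ring_hom A K \<and> \<phi> c \<in> Units K))"

section \<open>Specializing a ring generated by one more element\<close>

text \<open>\<open>L\<close> is a copy of K[X]/(h'), where h' is the image of \<open>h\<close> under
  \<open>\<phi>\<close>. Since a unit of the nonzero ring \<open>K\<close> is nonzero, the degree of
  \<open>h\<close> does not drop; positive degree and the unit leading coefficient then make
  \<open>L\<close> nonzero and finite. The algebraic case takes for \<open>h\<close> a relation of
  least degree, the transcendental case a polynomial built to invert a given one.\<close>

lemma ring_hom_UP_quotient:
  assumes "cring A" "cring K" "finite (carrier K)" "\<one>\<^bsub>K\<^esub> \<noteq> \<zero>\<^bsub>K\<^esub>" "\<phi> \<in> ring_hom A K"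
    and h: "h \<in> carrier (UP A)" "deg A h > 0" "\<phi> (up_ring.coeff (UP A) h (deg A h)) \<in> Units K"
  obtains L :: "nat ring" and \<Psi> where "cring L" "finite (carrier L)" "\<one>\<^bsub>L\<^esub> \<noteq> \<zero>\<^bsub>L\<^esub>"
    "\<Psi> \<in> ring_hom (UP A) L" "\<Psi> h = \<zero>\<^bsub>L\<^esub>"
    "\<And>c. c \<in> carrier A \<Longrightarrow> \<phi> c \<in> Units K \<Longrightarrow> \<Psi> (up_ring.monom (UP A) c 0) \<in> Units L"
proof -
  interpret h: ring_hom_cring A K \<phi> using assms by (intro ring_hom_cringI)
  interpret A: UP_cring A "UP A" using assms(1) by (simp add: UP_cring_def)
  interpret K: UP_cring K "UP K" using assms(2) by (simp add: UP_cring_def)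
  define \<Phi> where "\<Phi> = (\<lambda>p (n :: nat). \<phi> (p n))"
  have \<Phi>: "\<Phi> \<in> ring_hom (UP A) (UP K)"
    unfolding \<Phi>_def using assms by (intro ring_hom_UP)
  have \<Phi>h: "\<Phi> h \<in> carrier (UP K)" using ring_hom_memE(1)[OF \<Phi>] h by blast
  have coeff: "up_ring.coeff (UP K) (\<Phi> h) n = \<phi> (up_ring.coeff (UP A) h n)" for n
    unfolding coeff_UP_eta[OF h(1)] coeff_UP_eta[OF \<Phi>h] by (simp add: \<Phi>_def)
  have unit0: "\<zero>\<^bsub>K\<^esub> \<notin> Units K"
    using assms(4) h.S.Units_r_inv[of "\<zero>\<^bsub>K\<^esub>"] h.S.l_null h.S.Units_inv_closed by metis
  have deg: "deg K (\<Phi> h) = deg A h"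
  proof (rule K.deg_eq_of_coeffs[OF \<Phi>h])
    show "up_ring.coeff (UP K) (\<Phi> h) n = \<zero>\<^bsub>K\<^esub>" if "deg A h < n" for n
      using A.deg_aboveD[OF that h(1)] by (simp add: coeff)
    show "up_ring.coeff (UP K) (\<Phi> h) (deg A h) \<noteq> \<zero>\<^bsub>K\<^esub>" using h(3) unit0 by (metis coeff)
  qed
  let ?J = "PIdl\<^bsub>UP K\<^esub> (\<Phi> h)"
  interpret J: ideal ?J "UP K" using \<Phi>h by (rule K.P.cgenideal_ideal)
  let ?Q = "UP K Quot ?J"
  have u: "K.lcoeff (\<Phi> h) \<in> Units K" using h(3) by (simp add: coeff deg)
  have Q: "cring ?Q" by (rule J.quotient_is_cring[OF K.UP_cring])
  have "finite (carrier ?Q)" by (rule K.finite_quotient_unit_lcoeff[OF assms(3) \<Phi>h u assms(4)])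
  then obtain L :: "nat ring" and f where L: "cring L" "finite (carrier L)" and f: "f \<in> ring_iso ?Q L"
    using finite_cring_nat_copy[OF Q] by blast
  interpret L: cring L by fact
  interpret Q: cring ?Q by fact
  have fh: "f \<in> ring_hom ?Q L" using f by (simp add: ring_iso_def)
  interpret f: ring_hom_ring ?Q L f using fh by (intro ring_hom_ringI2 Q.ring_axioms L.ring_axioms)
  let ?\<Psi> = "f \<circ> ((+>\<^bsub>UP K\<^esub>) ?J \<circ> \<Phi>)"
  have "\<one>\<^bsub>?Q\<^esub> \<noteq> \<zero>\<^bsub>?Q\<^esub>"
  proof
    assume "\<one>\<^bsub>?Q\<^esub> = \<zero>\<^bsub>?Q\<^esub>"
    then have "?J +>\<^bsub>UP K\<^esub> \<one>\<^bsub>UP K\<^esub> = ?J" by (simp add: FactRing_def)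
    then have "\<one>\<^bsub>UP K\<^esub> \<in> ?J" using J.a_rcos_self[of "\<one>\<^bsub>UP K\<^esub>"] by auto
    then show False using K.one_notin_PIdl_unit_lcoeff[OF \<Phi>h u assms(4)] h(2) deg by simp
  qed
  then have nt: "\<one>\<^bsub>L\<^esub> \<noteq> \<zero>\<^bsub>L\<^esub>"
    using ring_iso_memE(5)[OF f] f.hom_one f.hom_zero Q.one_closed Q.zero_closed
    unfolding bij_betw_def inj_on_def by metis
  have \<Psi>: "?\<Psi> \<in> ring_hom (UP A) L"
    by (rule ring_hom_trans[OF ring_hom_trans[OF \<Phi> J.rcos_ring_hom] fh])
  have "\<Phi> h \<in> ?J" using \<Phi>h by (rule K.P.cgenideal_self)
  then have "?\<Psi> h = \<zero>\<^bsub>L\<^esub>" using f.hom_zero J.a_rcos_const by (simp add: FactRing_def)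
  moreover have "?\<Psi> (up_ring.monom (UP A) c 0) \<in> Units L" if c: "c \<in> carrier A" "\<phi> c \<in> Units K" for c
  proof -
    \<comment> \<open>On constants the map factors through \<open>\<phi>\<close> and this
      homomorphism from \<open>K\<close> to \<open>L\<close>, and homomorphisms preserve
      units.\<close>
    let ?g = "f \<circ> ((+>\<^bsub>UP K\<^esub>) ?J \<circ> (\<lambda>a. up_ring.monom (UP K) a 0))"
    have g: "?g \<in> ring_hom K L"
      by (rule ring_hom_trans[OF ring_hom_trans[OF K.const_ring_hom J.rcos_ring_hom] fh])
    have "?g (\<phi> c) \<in> Units L" by (rule ring_hom_Units[OF h.S.monoid_axioms g c(2)])
    moreover have "\<Phi> (up_ring.monom (UP A) c 0) = up_ring.monom (UP K) (\<phi> c) 0"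
      using c(1) by (auto simp: \<Phi>_def UP_def)
    ultimately show ?thesis by simp
  qed
  ultimately show ?thesis using that L nt \<Psi> by blast
qed

text \<open>
  With \<open>f\<close> of least degree in the kernel of \<open>e\<close>, pseudo-division shows that \<open>d\<close> divides a nonzero
  constant \<open>c0\<close>. Specialize the product of \<open>c0\<close> and the leading coefficient of \<open>f\<close> to a unit and pass
  to \<open>K[X]/(f)\<close>.
\<close>

lemma unit_specializable_adjoin_algebraic:
  assumes "domain A" "domain B" "e \<in> ring_hom (UP A) B" "e ` carrier (UP A) = carrier B"
    and e0: "\<And>a. a \<in> carrier A \<Longrightarrow> e (up_ring.monom (UP A) a 0) = \<zero>\<^bsub>B\<^esub> \<Longrightarrow> a = \<zero>\<^bsub>A\<^esub>"
    and "unit_specializable A"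
    and alg: "\<exists>f\<in>carrier (UP A). f \<noteq> \<zero>\<^bsub>UP A\<^esub> \<and> e f = \<zero>\<^bsub>B\<^esub>"
  shows "unit_specializable B"
  unfolding unit_specializable_def
proof (intro ballI impI)
  interpret A: UP_domain A "UP A" using assms(1) by (simp add: UP_domain_def)
  interpret B: domain B by fact
  interpret e: ring_hom_ring "UP A" B e
    using assms(3) by (intro ring_hom_ringI2 A.P.ring_axioms B.ring_axioms)
  let ?m = "\<lambda>a. up_ring.monom (UP A) a 0"
  fix d assume d: "d \<in> carrier B" "d \<noteq> \<zero>\<^bsub>B\<^esub>"
  let ?P = "\<lambda>f. f \<in> carrier (UP A) \<and> f \<noteq> \<zero>\<^bsub>UP A\<^esub> \<and> e f = \<zero>\<^bsub>B\<^esub>"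
  obtain f where f: "f \<in> carrier (UP A)" "f \<noteq> \<zero>\<^bsub>UP A\<^esub>" "e f = \<zero>\<^bsub>B\<^esub>"
    and fmin: "\<And>g. ?P g \<Longrightarrow> deg A f \<le> deg A g"
    using alg ex_has_least_nat[of ?P _ "deg A"] by blast
  \<comment> \<open>Polynomials that represent a nonzero multiple of \<open>d\<close>. One of least
    degree will turn out to be constant; it is the promised \<open>c0\<close>.\<close>
  let ?C = "\<lambda>r. r \<in> carrier (UP A) \<and> e r \<noteq> \<zero>\<^bsub>B\<^esub> \<and> (\<exists>b\<in>carrier B. e r = d \<otimes>\<^bsub>B\<^esub> b)"
  obtain g where g: "g \<in> carrier (UP A)" "e g = d" using d(1) assms(4) by (metis imageE)
  have "?C g" using g d by (auto intro!: bexI[of _ "\<one>\<^bsub>B\<^esub>"])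
  then obtain r where r: "r \<in> carrier (UP A)" "e r \<noteq> \<zero>\<^bsub>B\<^esub>" "\<exists>b\<in>carrier B. e r = d \<otimes>\<^bsub>B\<^esub> b"
    and rmin: "\<And>g. ?C g \<Longrightarrow> deg A r \<le> deg A g"
    using ex_has_least_nat[of ?C g "deg A"] by blast
  from r(3) obtain b where b: "b \<in> carrier B" "e r = d \<otimes>\<^bsub>B\<^esub> b" by blast
  have nz: "p \<noteq> \<zero>\<^bsub>UP A\<^esub>" if "e p \<noteq> \<zero>\<^bsub>B\<^esub>" for p using that by auto
  have const: "e (a \<odot>\<^bsub>UP A\<^esub> p) = e (?m a) \<otimes>\<^bsub>B\<^esub> e p" if "a \<in> carrier A" "p \<in> carrier (UP A)" for a p
    using that by (simp add: A.monom_mult_is_smult[symmetric])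
  have pow: "A.lcoeff p [^]\<^bsub>A\<^esub> (k::nat) \<in> carrier A" if "p \<in> carrier (UP A)" for p k
    using that by simp
  have pow0: "A.lcoeff p [^]\<^bsub>A\<^esub> (k::nat) \<noteq> \<zero>\<^bsub>A\<^esub>" if "p \<in> carrier (UP A)" "p \<noteq> \<zero>\<^bsub>UP A\<^esub>" for p k
    using that by (induction k) (auto simp: A.R.integral_iff A.lcoeff_nonzero2)
  have epow0: "e (?m (A.lcoeff p [^]\<^bsub>A\<^esub> (k::nat))) \<noteq> \<zero>\<^bsub>B\<^esub>" if "p \<in> carrier (UP A)" "p \<noteq> \<zero>\<^bsub>UP A\<^esub>" for p k
    using e0[OF pow] pow0 that by blast
  \<comment> \<open>Modulo \<open>f\<close>, the polynomial \<open>r\<close> becomes a remainder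
    whose image is a nonzero constant times \<open>e r\<close>, hence still a nonzero multiple of
    \<open>d\<close> because \<open>B\<close> is a domain. Minimality of \<open>r\<close> bounds its
    degree by that of the remainder.\<close>
  have rf: "deg A r < deg A f"
  proof -
    obtain q s k where qs: "q \<in> carrier (UP A)" "s \<in> carrier (UP A)" "s = \<zero>\<^bsub>UP A\<^esub> \<or> deg A s < deg A f"
      and eq: "A.lcoeff f [^]\<^bsub>A\<^esub> (k::nat) \<odot>\<^bsub>UP A\<^esub> r = f \<otimes>\<^bsub>UP A\<^esub> q \<oplus>\<^bsub>UP A\<^esub> s"
      using A.long_div_theorem[OF f(1) r(1) f(2)] by blast
    let ?c = "e (?m (A.lcoeff f [^]\<^bsub>A\<^esub> k))"
    have c: "?c \<in> carrier B" using pow[OF f(1)] by simp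
    have "?c \<otimes>\<^bsub>B\<^esub> e r = e (f \<otimes>\<^bsub>UP A\<^esub> q \<oplus>\<^bsub>UP A\<^esub> s)"
      using const[OF pow[OF f(1), of k] r(1)] unfolding eq by (rule sym)
    then have es: "e s = ?c \<otimes>\<^bsub>B\<^esub> e r" using f qs by simp
    have "e s \<noteq> \<zero>\<^bsub>B\<^esub>"
      using es B.integral[of ?c "e r"] epow0[OF f(1,2)] r c by auto
    moreover have "e s = d \<otimes>\<^bsub>B\<^esub> (b \<otimes>\<^bsub>B\<^esub> ?c)" using es b c d(1) by (simp add: B.m_ac)
    ultimately have "deg A r \<le> deg A s" using rmin[of s] qs b c by blast
    moreover have "deg A s < deg A f" using qs(3) nz \<open>e s \<noteq> \<zero>\<^bsub>B\<^esub>\<close> by blast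
    ultimately show ?thesis by linarith
  qed
  have degf: "deg A f > 0" using rf by linarith
  have r0: "r \<noteq> \<zero>\<^bsub>UP A\<^esub>" using r(2) nz by blast
  \<comment> \<open>Now divide \<open>f\<close> by \<open>r\<close>. The image of the remainder is
    again a multiple of \<open>d\<close>, so minimality of \<open>r\<close> makes it zero; since
    \<open>e r\<close> is nonzero in a domain, the quotient \<open>q\<close> is a relation too. If
    \<open>r\<close> had positive degree, \<open>q\<close> would be a nonzero relation of degree
    below that of \<open>f\<close>.\<close>
  have deg0: "deg A r = 0"
  proof (rule ccontr)
    assume dr: "deg A r \<noteq> 0"
    obtain q s k where qs: "q \<in> carrier (UP A)" "s \<in> carrier (UP A)" "s = \<zero>\<^bsub>UP A\<^esub> \<or> deg A s < deg A r"
      and eq: "A.lcoeff r [^]\<^bsub>A\<^esub> (k::nat) \<odot>\<^bsub>UP A\<^esub> f = r \<otimes>\<^bsub>UP A\<^esub> q \<oplus>\<^bsub>UP A\<^esub> s"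
      using A.long_div_theorem[OF r(1) f(1) r0] by blast
    let ?u = "A.lcoeff r [^]\<^bsub>A\<^esub> k"
    have u: "?u \<in> carrier A" "?u \<noteq> \<zero>\<^bsub>A\<^esub>" using pow pow0 r(1) r0 by blast+
    have "e (r \<otimes>\<^bsub>UP A\<^esub> q \<oplus>\<^bsub>UP A\<^esub> s) = \<zero>\<^bsub>B\<^esub>"
      using const[OF u(1) f(1)] f u unfolding eq by simp
    then have ers: "e r \<otimes>\<^bsub>B\<^esub> e q \<oplus>\<^bsub>B\<^esub> e s = \<zero>\<^bsub>B\<^esub>" using r qs by simp
    then have es: "e s = \<ominus>\<^bsub>B\<^esub> (e r \<otimes>\<^bsub>B\<^esub> e q)"
      using r qs B.minus_equality[of "e s" "e r \<otimes>\<^bsub>B\<^esub> e q"] B.a_comm[of "e s" "e r \<otimes>\<^bsub>B\<^esub> e q"] by simp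
    also have "\<dots> = d \<otimes>\<^bsub>B\<^esub> (\<ominus>\<^bsub>B\<^esub> (b \<otimes>\<^bsub>B\<^esub> e q))"
      using b d qs by (simp add: B.m_assoc B.r_minus)
    finally have es': "e s = d \<otimes>\<^bsub>B\<^esub> (\<ominus>\<^bsub>B\<^esub> (b \<otimes>\<^bsub>B\<^esub> e q))" .
    have es0: "e s = \<zero>\<^bsub>B\<^esub>"
    proof (rule ccontr)
      assume "e s \<noteq> \<zero>\<^bsub>B\<^esub>"
      moreover have "\<ominus>\<^bsub>B\<^esub> (b \<otimes>\<^bsub>B\<^esub> e q) \<in> carrier B" using b qs by simp
      ultimately have "?C s"
        using qs(2) es' by (intro conjI bexI[of _ "\<ominus>\<^bsub>B\<^esub> (b \<otimes>\<^bsub>B\<^esub> e q)"])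
      then have "deg A r \<le> deg A s" by (rule rmin)
      moreover have "deg A s < deg A r" using qs(3) nz \<open>e s \<noteq> \<zero>\<^bsub>B\<^esub>\<close> by blast
      ultimately show False by linarith
    qed
    then have "e r \<otimes>\<^bsub>B\<^esub> e q = \<zero>\<^bsub>B\<^esub>" using ers r qs by simp
    then have eq0: "e q = \<zero>\<^bsub>B\<^esub>" using B.integral[of "e r" "e q"] r qs by auto
    have deguf: "deg A (?u \<odot>\<^bsub>UP A\<^esub> f) = deg A f" using u f by simp
    have q0: "q \<noteq> \<zero>\<^bsub>UP A\<^esub>"
    proof
      assume "q = \<zero>\<^bsub>UP A\<^esub>"
      then have "?u \<odot>\<^bsub>UP A\<^esub> f = s" using eq r qs by simp
      then show False using deguf qs(3) rf by auto
    qed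
    have "deg A (r \<otimes>\<^bsub>UP A\<^esub> q) = deg A r + deg A q" using r0 q0 r qs by simp
    moreover have "deg A s \<le> deg A r" using qs(3) by auto
    \<comment> \<open>Otherwise the index deg r + deg q exceeds deg f and the degree of the
      remainder, so the product of the two leading coefficients would be zero. Positivity of deg r
      enters here.\<close>
    have "deg A q < deg A f"
    proof (rule ccontr)
      assume "\<not> deg A q < deg A f"
      then have lt: "deg A f < deg A r + deg A q" using dr by linarith
      have "up_ring.coeff (UP A) (?u \<odot>\<^bsub>UP A\<^esub> f) (deg A r + deg A q) = \<zero>\<^bsub>A\<^esub>"
        using A.deg_aboveD[of "?u \<odot>\<^bsub>UP A\<^esub> f"] deguf lt u f by simp
      moreover have "up_ring.coeff (UP A) s (deg A r + deg A q) = \<zero>\<^bsub>A\<^esub>"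
        using A.deg_aboveD[of s] qs rf lt \<open>deg A s \<le> deg A r\<close> \<open>\<not> deg A q < deg A f\<close> by simp
      ultimately have "A.lcoeff r \<otimes>\<^bsub>A\<^esub> A.lcoeff q = \<zero>\<^bsub>A\<^esub>"
        using A.coeff_mult_deg_sum[OF r(1) qs(1)] eq A.coeff_add[of "r \<otimes>\<^bsub>UP A\<^esub> q" s] r qs
        by simp
      then show False
        using A.R.integral_iff[of "A.lcoeff r" "A.lcoeff q"] A.lcoeff_nonzero2 r0 q0 r qs by auto
    qed
    then show False using fmin[of q] qs q0 eq0 by auto
  qed
  define c0 where "c0 = up_ring.coeff (UP A) r 0"
  have c0: "c0 \<in> carrier A" "r = ?m c0" "c0 \<noteq> \<zero>\<^bsub>A\<^esub>"
    using A.deg_zero_impl_monom[OF r(1) deg0] r(1) A.lcoeff_nonzero2[OF r(1) r0] deg0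
    by (simp_all add: c0_def)
  let ?a = "A.lcoeff f"
  have a: "?a \<in> carrier A" "?a \<noteq> \<zero>\<^bsub>A\<^esub>" using f A.lcoeff_nonzero2 by auto
  have "?a \<otimes>\<^bsub>A\<^esub> c0 \<in> carrier A" "?a \<otimes>\<^bsub>A\<^esub> c0 \<noteq> \<zero>\<^bsub>A\<^esub>"
    using a c0 A.R.integral_iff[of ?a c0] by auto
  then obtain K :: "nat ring" and \<phi> where K: "cring K" "finite (carrier K)" "\<one>\<^bsub>K\<^esub> \<noteq> \<zero>\<^bsub>K\<^esub>"
    and \<phi>: "\<phi> \<in> ring_hom A K" "\<phi> (?a \<otimes>\<^bsub>A\<^esub> c0) \<in> Units K"
    using assms(6) unfolding unit_specializable_def by blast
  interpret K: cring K by fact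
  have eqm: "\<phi> (?a \<otimes>\<^bsub>A\<^esub> c0) = \<phi> ?a \<otimes>\<^bsub>K\<^esub> \<phi> c0" using ring_hom_memE(2)[OF \<phi>(1)] a c0 by blast
  have cl: "\<phi> ?a \<in> carrier K" "\<phi> c0 \<in> carrier K" using ring_hom_memE(1)[OF \<phi>(1)] a c0 by blast+
  have ua: "\<phi> ?a \<in> Units K" using \<phi>(2) eqm cl K.Units_of_mult_unit by metis
  have uc: "\<phi> c0 \<in> Units K" using \<phi>(2) eqm cl K.Units_of_mult_unit K.m_comm by metis
  obtain L :: "nat ring" and \<Psi> where L: "cring L" "finite (carrier L)" "\<one>\<^bsub>L\<^esub> \<noteq> \<zero>\<^bsub>L\<^esub>"
    and \<Psi>: "\<Psi> \<in> ring_hom (UP A) L" "\<Psi> f = \<zero>\<^bsub>L\<^esub>"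
    and \<Psi>u: "\<And>c. c \<in> carrier A \<Longrightarrow> \<phi> c \<in> Units K \<Longrightarrow> \<Psi> (?m c) \<in> Units L"
    by (rule ring_hom_UP_quotient[OF A.R.cring_axioms K \<phi>(1) f(1) degf ua], rule that)
  interpret L: cring L by fact
  interpret \<Psi>: ring_hom_ring "UP A" L \<Psi>
    using \<Psi>(1) by (intro ring_hom_ringI2 A.P.ring_axioms L.ring_axioms)
  \<comment> \<open>Relations need not be multiples of \<open>f\<close>, only up to a power of its
    leading coefficient: the pseudo-remainder is a relation of smaller degree, hence zero. As that
    coefficient becomes a unit in \<open>L\<close>, killing \<open>f\<close> is enough to kill every
    relation.\<close>
  have "\<Psi> p = \<zero>\<^bsub>L\<^esub>" if p: "p \<in> carrier (UP A)" "e p = \<zero>\<^bsub>B\<^esub>" for p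
  proof -
    obtain q s k where qs: "q \<in> carrier (UP A)" "s \<in> carrier (UP A)" "s = \<zero>\<^bsub>UP A\<^esub> \<or> deg A s < deg A f"
      and eq: "?a [^]\<^bsub>A\<^esub> (k::nat) \<odot>\<^bsub>UP A\<^esub> p = f \<otimes>\<^bsub>UP A\<^esub> q \<oplus>\<^bsub>UP A\<^esub> s"
      using A.long_div_theorem[OF f(1) p(1) f(2)] by blast
    have "e (f \<otimes>\<^bsub>UP A\<^esub> q \<oplus>\<^bsub>UP A\<^esub> s) = \<zero>\<^bsub>B\<^esub>"
      using const[OF pow[OF f(1), of k] p(1)] p(2) pow[OF f(1), of k] unfolding eq by simp
    then have "e s = \<zero>\<^bsub>B\<^esub>" using f qs by simp
    then have "s = \<zero>\<^bsub>UP A\<^esub>" using fmin[of s] qs not_less by blast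
    then have "?m (?a [^]\<^bsub>A\<^esub> k) \<otimes>\<^bsub>UP A\<^esub> p = f \<otimes>\<^bsub>UP A\<^esub> q"
      using eq f qs p pow[OF f(1)] by (simp add: A.monom_mult_is_smult)
    then have "\<Psi> (?m (?a [^]\<^bsub>A\<^esub> k) \<otimes>\<^bsub>UP A\<^esub> p) = \<zero>\<^bsub>L\<^esub>" using f qs \<Psi>(2) by simp
    then have z: "\<Psi> (?m (?a [^]\<^bsub>A\<^esub> k)) \<otimes>\<^bsub>L\<^esub> \<Psi> p = \<zero>\<^bsub>L\<^esub>" using pow[OF f(1)] p by simp
    have "\<phi> (?a [^]\<^bsub>A\<^esub> k) = \<phi> ?a [^]\<^bsub>K\<^esub> k"
    proof -
      interpret \<phi>: ring_hom_cring A K \<phi> using \<phi>(1) by (intro ring_hom_cringI) (unfold_locales)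
      show ?thesis using a by simp
    qed
    then have "\<phi> (?a [^]\<^bsub>A\<^esub> k) \<in> Units K" using K.Units_pow_closed[OF ua] by simp
    then have u: "\<Psi> (?m (?a [^]\<^bsub>A\<^esub> k)) \<in> Units L" using \<Psi>u pow[OF f(1)] by blast
    have "\<Psi> p = inv\<^bsub>L\<^esub> \<Psi> (?m (?a [^]\<^bsub>A\<^esub> k)) \<otimes>\<^bsub>L\<^esub> (\<Psi> (?m (?a [^]\<^bsub>A\<^esub> k)) \<otimes>\<^bsub>L\<^esub> \<Psi> p)"
      using u p by (simp add: L.m_assoc[symmetric] L.Units_closed)
    then show ?thesis using z u by simp
  qed
  then obtain \<theta> where \<theta>: "\<theta> \<in> ring_hom B L" "\<And>p. p \<in> carrier (UP A) \<Longrightarrow> \<theta> (e p) = \<Psi> p"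
    using ring_hom_factor[OF A.P.ring_axioms B.ring_axioms L.ring_axioms assms(3,4) \<Psi>(1)] by blast
  have "\<theta> (d \<otimes>\<^bsub>B\<^esub> b) \<in> Units L" using \<theta>(2)[OF r(1)] b \<Psi>u[OF c0(1) uc] c0(2) by simp
  then have "\<theta> d \<otimes>\<^bsub>L\<^esub> \<theta> b \<in> Units L" using ring_hom_memE(2)[OF \<theta>(1) d(1) b(1)] by simp
  then have "\<theta> d \<in> Units L" using L.Units_of_mult_unit ring_hom_memE(1)[OF \<theta>(1)] d(1) b(1) by blast
  then show "\<exists>(K :: nat ring) \<phi>. cring K \<and> finite (carrier K) \<and> \<one>\<^bsub>K\<^esub> \<noteq> \<zero>\<^bsub>K\<^esub> \<and>
        \<phi> \<in> ring_hom B K \<and> \<phi> d \<in> Units K"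
    using L \<theta>(1) by blast
qed

text \<open>
  Write \<open>d = e g\<close>. The polynomial \<open>g\<close> is inverted by \<open>-X\<close> modulo \<open>1 + X g\<close>, whose leading coefficient is
  that of \<open>g\<close>.
\<close>

lemma unit_specializable_adjoin_transcendental:
  assumes "domain A" "domain B" "e \<in> ring_hom (UP A) B" "e ` carrier (UP A) = carrier B"
    and "unit_specializable A"
    and inj: "\<And>f. f \<in> carrier (UP A) \<Longrightarrow> e f = \<zero>\<^bsub>B\<^esub> \<Longrightarrow> f = \<zero>\<^bsub>UP A\<^esub>"
  shows "unit_specializable B"
  unfolding unit_specializable_def
proof (intro ballI impI)
  interpret A: UP_domain A "UP A" using assms(1) by (simp add: UP_domain_def)
  interpret B: domain B by fact
  interpret e: ring_hom_ring "UP A" B e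
    using assms(3) by (intro ring_hom_ringI2 A.P.ring_axioms B.ring_axioms)
  fix d assume d: "d \<in> carrier B" "d \<noteq> \<zero>\<^bsub>B\<^esub>"
  obtain g where g: "g \<in> carrier (UP A)" "e g = d" using d(1) assms(4) by (metis imageE)
  then have g0: "g \<noteq> \<zero>\<^bsub>UP A\<^esub>" using d(2) by auto
  obtain K :: "nat ring" and \<phi> where K: "cring K" "finite (carrier K)" "\<one>\<^bsub>K\<^esub> \<noteq> \<zero>\<^bsub>K\<^esub>"
    and \<phi>: "\<phi> \<in> ring_hom A K" "\<phi> (A.lcoeff g) \<in> Units K"
    using assms(5) A.lcoeff_nonzero2[OF g(1) g0] A.lcoeff_closed[OF g(1)]
    unfolding unit_specializable_def by blast
  let ?X = "up_ring.monom (UP A) \<one>\<^bsub>A\<^esub> 1"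
  \<comment> \<open>The factor X makes the degree positive even when \<open>g\<close> is constant;
    otherwise the quotient could collapse to zero.\<close>
  let ?h = "\<one>\<^bsub>UP A\<^esub> \<oplus>\<^bsub>UP A\<^esub> ?X \<otimes>\<^bsub>UP A\<^esub> g"
  have X: "?X \<in> carrier (UP A)" by simp
  have h: "?h \<in> carrier (UP A)" using g by simp
  have cXg: "up_ring.coeff (UP A) (?X \<otimes>\<^bsub>UP A\<^esub> g) (Suc n) = up_ring.coeff (UP A) g n" for n
    using A.coeff_monom_mult[OF A.R.one_closed g(1), of 1 n] g by simp
  have ch: "up_ring.coeff (UP A) ?h (Suc n) = up_ring.coeff (UP A) g n" for n
    using g X A.coeff_add[of "\<one>\<^bsub>UP A\<^esub>" "?X \<otimes>\<^bsub>UP A\<^esub> g" "Suc n"] cXg by simp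
  have deg: "deg A ?h = Suc (deg A g)"
  proof (rule A.deg_eq_of_coeffs[OF h])
    show "up_ring.coeff (UP A) ?h n = \<zero>\<^bsub>A\<^esub>" if "Suc (deg A g) < n" for n
      using that ch[of "n - 1"] A.deg_aboveD[of g "n - 1"] g by (cases n) auto
    show "up_ring.coeff (UP A) ?h (Suc (deg A g)) \<noteq> \<zero>\<^bsub>A\<^esub>"
      using ch A.lcoeff_nonzero2[OF g(1) g0] by simp
  qed
  have degpos: "deg A ?h > 0" using deg by linarith
  have lc: "\<phi> (A.lcoeff ?h) \<in> Units K" unfolding deg ch using \<phi>(2) .
  obtain L :: "nat ring" and \<Psi> where L: "cring L" "finite (carrier L)" "\<one>\<^bsub>L\<^esub> \<noteq> \<zero>\<^bsub>L\<^esub>"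
    and \<Psi>: "\<Psi> \<in> ring_hom (UP A) L" "\<Psi> ?h = \<zero>\<^bsub>L\<^esub>"
    using ring_hom_UP_quotient[OF A.R.cring_axioms K \<phi>(1) h degpos lc] by blast
  interpret L: cring L by fact
  interpret \<Psi>: ring_hom_ring "UP A" L \<Psi>
    using \<Psi>(1) by (intro ring_hom_ringI2 A.P.ring_axioms L.ring_axioms)
  have "\<Psi> p = \<zero>\<^bsub>L\<^esub>" if p: "p \<in> carrier (UP A)" "e p = \<zero>\<^bsub>B\<^esub>" for p
    using inj[OF p] by simp
  then obtain \<theta> where \<theta>: "\<theta> \<in> ring_hom B L" "\<And>p. p \<in> carrier (UP A) \<Longrightarrow> \<theta> (e p) = \<Psi> p"
    using ring_hom_factor[OF A.P.ring_axioms B.ring_axioms L.ring_axioms assms(3,4) \<Psi>(1)] by blast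
  have "\<one>\<^bsub>L\<^esub> \<oplus>\<^bsub>L\<^esub> \<Psi> ?X \<otimes>\<^bsub>L\<^esub> \<Psi> g = \<zero>\<^bsub>L\<^esub>" using \<Psi>(2) g X by (simp del: A.monom_one_Suc)
  then have "\<Psi> ?X \<otimes>\<^bsub>L\<^esub> \<Psi> g = \<ominus>\<^bsub>L\<^esub> \<one>\<^bsub>L\<^esub>"
    using g X L.minus_equality[of "\<Psi> ?X \<otimes>\<^bsub>L\<^esub> \<Psi> g" "\<one>\<^bsub>L\<^esub>"] L.a_comm[of "\<one>\<^bsub>L\<^esub>" "\<Psi> ?X \<otimes>\<^bsub>L\<^esub> \<Psi> g"] by simp
  moreover have "\<Psi> g \<otimes>\<^bsub>L\<^esub> (\<ominus>\<^bsub>L\<^esub> \<Psi> ?X) = \<ominus>\<^bsub>L\<^esub> (\<Psi> ?X \<otimes>\<^bsub>L\<^esub> \<Psi> g)"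
    using g X L.m_comm[of "\<Psi> ?X" "\<Psi> g"] L.r_minus[of "\<Psi> g" "\<Psi> ?X"] by simp
  ultimately have "\<Psi> g \<otimes>\<^bsub>L\<^esub> (\<ominus>\<^bsub>L\<^esub> \<Psi> ?X) = \<one>\<^bsub>L\<^esub>" by simp
  then have "\<Psi> g \<in> Units L"
    using g X L.Units_of_mult_unit[of "\<Psi> g" "\<ominus>\<^bsub>L\<^esub> \<Psi> ?X"] by simp
  then have "\<theta> d \<in> Units L" using \<theta>(2)[OF g(1)] g(2) by simp
  then show "\<exists>(K :: nat ring) \<phi>. cring K \<and> finite (carrier K) \<and> \<one>\<^bsub>K\<^esub> \<noteq> \<zero>\<^bsub>K\<^esub> \<and>
        \<phi> \<in> ring_hom B K \<and> \<phi> d \<in> Units K"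
    using L \<theta>(1) by blast
qed

section \<open>The prime subring as the start of the induction\<close>

text \<open>A finite domain is a field, since multiplication by a nonzero element is injective and
  hence surjective. The ring therefore serves as its own specialization, up to copying it to
  \<open>nat\<close>.\<close>

lemma unit_specializable_finite_domain:
  assumes "domain D" "finite (carrier D)"
  shows "unit_specializable D"
  unfolding unit_specializable_def
proof (intro ballI impI)
  interpret D: domain D by fact
  fix c assume c: "c \<in> carrier D" "c \<noteq> \<zero>\<^bsub>D\<^esub>"
  have "inj_on (\<lambda>x. c \<otimes>\<^bsub>D\<^esub> x) (carrier D)"
    using c D.m_lcancel by (auto simp: inj_on_def)
  then have "(\<lambda>x. c \<otimes>\<^bsub>D\<^esub> x) ` carrier D = carrier D"
    using c assms(2) by (intro endo_inj_surj) auto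
  then obtain v where v: "v \<in> carrier D" "c \<otimes>\<^bsub>D\<^esub> v = \<one>\<^bsub>D\<^esub>"
    using D.one_closed by (metis imageE)
  then have u: "c \<in> Units D"
    using c D.m_comm[of c v] unfolding Units_def by (auto intro!: bexI[of _ v])
  obtain L :: "nat ring" and f where L: "cring L" "finite (carrier L)" "f \<in> ring_iso D L"
    using finite_cring_nat_copy[OF D.cring_axioms assms(2)] by blast
  have fh: "f \<in> ring_hom D L" using L(3) by (simp add: ring_iso_def)
  interpret f: ring_hom_ring D L f
    using fh L(1) by (intro ring_hom_ringI2 D.ring_axioms) (simp_all add: cring.axioms)
  have "\<one>\<^bsub>L\<^esub> \<noteq> \<zero>\<^bsub>L\<^esub>"
    using ring_iso_memE(5)[OF L(3)] f.hom_one f.hom_zero D.one_closed D.zero_closed D.one_not_zero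
    unfolding bij_betw_def inj_on_def by metis
  then show "\<exists>(K :: nat ring) \<phi>. cring K \<and> finite (carrier K) \<and> \<one>\<^bsub>K\<^esub> \<noteq> \<zero>\<^bsub>K\<^esub> \<and>
      \<phi> \<in> ring_hom D K \<and> \<phi> c \<in> Units K"
    using L fh ring_hom_Units[OF D.monoid_axioms fh u] by blast
qed

lemma (in ring) int_embedding_hom: "(\<lambda>n :: int. [n] \<cdot> \<one>) \<in> ring_hom \<Z> R"
proof (rule ring_hom_memI)
  fix x y :: int
  show "[(x \<oplus>\<^bsub>\<Z>\<^esub> y)] \<cdot> \<one> = [x] \<cdot> \<one> \<oplus> [y] \<cdot> \<one>"
    using add.int_pow_mult[of \<one> x y] by simp
  have "[x] \<cdot> \<one> \<otimes> [y] \<cdot> \<one> = [x] \<cdot> ([y] \<cdot> \<one>)"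
    using add_pow_ldistr_int[of \<one> "[y] \<cdot> \<one>" x] add.int_pow_closed by simp
  then show "[(x \<otimes>\<^bsub>\<Z>\<^esub> y)] \<cdot> \<one> = [x] \<cdot> \<one> \<otimes> [y] \<cdot> \<one>"
    using add.int_pow_pow[of \<one> x y] by (simp add: mult.commute)
qed (simp_all add: add.int_pow_1 add.int_pow_closed)

lemma mod_residue_ring_hom:
  assumes "m > 1"
  shows "(\<lambda>n. n mod m) \<in> ring_hom \<Z> (residue_ring m)"
proof -
  interpret residues m "residue_ring m" using assms by (simp add: residues_def)
  show ?thesis
    using assms by (intro ring_hom_memI) (auto simp: residue_ring_def mod_simps)
qed

text \<open>The image of the integers is either a copy of them, where reduction modulo a suitable
  integer works, or a finite domain.\<close>

lemma unit_specializable_prime_subring: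
  assumes "domain R"
  obtains D where "subring D R" "unit_specializable (R\<lparr>carrier := D\<rparr>)"
proof -
  interpret domain R by fact
  define e where "e = (\<lambda>n :: int. [n] \<cdot>\<^bsub>R\<^esub> \<one>\<^bsub>R\<^esub>)"
  have e: "e \<in> ring_hom \<Z> R" unfolding e_def by (rule int_embedding_hom)
  have Zr: "ring \<Z>" using int_is_cring by (simp add: cring.axioms)
  interpret e: ring_hom_ring \<Z> R e using e by (intro ring_hom_ringI2 ring_axioms Zr)
  have sub: "subring (range e) R"
    using e.img_is_subring[OF ring.carrier_is_subring[OF Zr]] by simp
  let ?D = "R\<lparr>carrier := range e\<rparr>"
  interpret D: domain ?D using sub by (rule subring_is_domain)
  have "unit_specializable ?D"
  proof (cases "inj e")
    case True
    have e0: "e 0 = \<zero>\<^bsub>R\<^esub>" using e.hom_zero by simp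
    show ?thesis
      unfolding unit_specializable_def
    proof (intro ballI impI)
      fix c assume "c \<in> carrier ?D" "c \<noteq> \<zero>\<^bsub>?D\<^esub>"
      then obtain N where N: "c = e N" "e N \<noteq> \<zero>\<^bsub>R\<^esub>" by auto
      then have "N \<noteq> 0" using e0 by metis
      \<comment> \<open>Modulo this number \<open>N\<close> is congruent to 1 or -1, hence a unit,
        so no prime avoiding \<open>N\<close> has to be found. The modulus exceeds 1 because
        \<open>N\<close> is nonzero.\<close>
      let ?m = "\<bar>N\<bar> + 1"
      have m: "?m > 1" using \<open>N \<noteq> 0\<close> by simp
      interpret Zm: residues ?m "residue_ring ?m" using m by (simp add: residues_def)
      have "N mod ?m \<in> Units (residue_ring ?m)"
      proof -
        have cop: "coprime N ?m"
        proof (rule coprimeI)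
          fix a assume "a dvd N" "a dvd ?m"
          then have "a dvd ?m - \<bar>N\<bar>" by (intro dvd_diff) simp_all
          then show "is_unit a" by simp
        qed
        then have "coprime (N mod ?m) ?m" using m by simp
        moreover from this have "N mod ?m \<noteq> 0"
        proof (rule contrapos_pn)
          assume "N mod ?m = 0"
          then show "\<not> coprime (N mod ?m) ?m"
            using m zdvd1_eq[of ?m] by (metis abs_of_pos coprime_0_left_iff less_irrefl less_trans zero_less_one)
        qed
        ultimately show ?thesis
          unfolding Zm.res_units_eq using m pos_mod_bound[of ?m N] pos_mod_sign[of ?m N] by force
      qed
      have one: "\<one>\<^bsub>residue_ring ?m\<^esub> \<noteq> \<zero>\<^bsub>residue_ring ?m\<^esub>" by (simp add: residue_ring_def)
      have eD: "e \<in> ring_hom \<Z> ?D" using e by (simp add: ring_hom_def)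
      have surj: "e ` carrier \<Z> = carrier ?D" by simp
      have ker: "p mod ?m = \<zero>\<^bsub>residue_ring ?m\<^esub>" if "p \<in> carrier \<Z>" "e p = \<zero>\<^bsub>?D\<^esub>" for p
      proof -
        have "p = 0" using that(2) e0 injD[OF True, of p 0] by simp
        then show ?thesis by (simp add: residue_ring_def)
      qed
      obtain g where g: "g \<in> ring_hom ?D (residue_ring ?m)" "\<And>p. p \<in> carrier \<Z> \<Longrightarrow> g (e p) = p mod ?m"
        by (rule ring_hom_factor[OF Zr D.ring_axioms Zm.ring_axioms eD surj mod_residue_ring_hom[OF m]])
          (erule (1) ker, rule that)
      have gc: "g c \<in> Units (residue_ring ?m)"
        using g(2)[of N] N \<open>N mod ?m \<in> Units (residue_ring ?m)\<close> by simp
      obtain L :: "nat ring" and f where L: "cring L" "finite (carrier L)" "f \<in> ring_iso (residue_ring ?m) L"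
        using finite_cring_nat_copy[OF Zm.cring_axioms] by blast
      have fh: "f \<in> ring_hom (residue_ring ?m) L" using L(3) by (simp add: ring_iso_def)
      interpret f: ring_hom_ring "residue_ring ?m" L f
        using fh L(1) by (intro ring_hom_ringI2 Zm.ring_axioms) (simp_all add: cring.axioms)
      have "\<one>\<^bsub>L\<^esub> \<noteq> \<zero>\<^bsub>L\<^esub>"
        using ring_iso_memE(5)[OF L(3)] f.hom_one f.hom_zero Zm.one_closed Zm.zero_closed one
        unfolding bij_betw_def inj_on_def by metis
      moreover have "f \<circ> g \<in> ring_hom ?D L" using ring_hom_trans[OF g(1) fh] .
      moreover have "(f \<circ> g) c \<in> Units L"
        using ring_hom_Units[OF Zm.monoid_axioms fh gc] by simp
      ultimately show "\<exists>(K :: nat ring) \<phi>. cring K \<and> finite (carrier K) \<and> \<one>\<^bsub>K\<^esub> \<noteq> \<zero>\<^bsub>K\<^esub> \<and>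
          \<phi> \<in> ring_hom ?D K \<and> \<phi> c \<in> Units K"
        using L by blast
    qed
  next
    case False
    then obtain a b where ab: "e a = e b" "a < b" by (metis injI linorder_neqE)
    \<comment> \<open>A collision makes \<open>e\<close> periodic with this period, so the residues
      below it already exhaust the image.\<close>
    let ?m = "b - a"
    have "e ?m \<oplus>\<^bsub>R\<^esub> e a = e a" using e.hom_add[of ?m a] ab(1) by simp
    then have em: "e ?m = \<zero>\<^bsub>R\<^esub>"
      using add.r_cancel_one[of "e a" "e ?m"] e.hom_closed[of a] e.hom_closed[of ?m] by simp
    have "e n = e (n mod ?m)" for n
    proof -
      have "e n = e (?m * (n div ?m) + n mod ?m)" by simp
      also have "\<dots> = e ?m \<otimes>\<^bsub>R\<^esub> e (n div ?m) \<oplus>\<^bsub>R\<^esub> e (n mod ?m)"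
        using e.hom_add[of "?m * (n div ?m)" "n mod ?m"] e.hom_mult[of ?m "n div ?m"] by simp
      also have "\<dots> = e (n mod ?m)"
        using em e.hom_closed[of "n div ?m"] e.hom_closed[of "n mod ?m"] by simp
      finally show ?thesis .
    qed
    then have "range e \<subseteq> e ` {0..<?m}" using ab(2) by force
    then have "finite (range e)" by (rule finite_subset) simp
    then show ?thesis using unit_specializable_finite_domain[OF D.domain_axioms] by simp
  qed
  with sub that show ?thesis by blast
qed

section \<open>From one generator to finitely many elements of a domain\<close>

text \<open>\<open>D'\<close> is the ring D[x], the image of evaluation at \<open>x\<close>. The
  case distinction is whether \<open>x\<close> is algebraic over \<open>D\<close>; in the algebraic
  case constants must not be killed, which holds since evaluation fixes \<open>D\<close>.\<close>

lemma unit_specializable_adjoin: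
  assumes "domain R" "subring D R" "unit_specializable (R\<lparr>carrier := D\<rparr>)" "x \<in> carrier R"
  obtains D' where "subring D' R" "D \<subseteq> D'" "x \<in> D'" "unit_specializable (R\<lparr>carrier := D'\<rparr>)"
proof -
  interpret domain R by fact
  let ?A = "R\<lparr>carrier := D\<rparr>"
  interpret A: domain ?A using assms(2) by (rule subring_is_domain)
  have DR: "D \<subseteq> carrier R" using assms(2) by (rule subringE)
  interpret AP: UP_cring ?A "UP ?A" by (simp add: UP_cring_def A.cring_axioms)
  have "id \<in> ring_hom ?A R" using DR by (auto simp: ring_hom_def)
  then interpret U: UP_pre_univ_prop ?A R id "UP ?A"
    by (intro UP_pre_univ_propI) (unfold_locales)
  define e where "e = UnivPoly.eval ?A R id x"
  have e: "e \<in> ring_hom (UP ?A) R" unfolding e_def using assms(4) by (rule U.eval_ring_hom)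
  interpret e: ring_hom_ring "UP ?A" R e
    using e by (intro ring_hom_ringI2 ring_axioms AP.P.ring_axioms)
  let ?D = "e ` carrier (UP ?A)"
  have sub: "subring ?D R" by (rule e.img_is_subring[OF AP.P.carrier_is_subring])
  let ?B = "R\<lparr>carrier := ?D\<rparr>"
  interpret B: domain ?B using sub by (rule subring_is_domain)
  have const: "e (up_ring.monom (UP ?A) a 0) = a" if "a \<in> D" for a
    unfolding e_def using U.eval_const[OF assms(4), of a] that by simp
  have X: "e (up_ring.monom (UP ?A) \<one>\<^bsub>R\<^esub> 1) = x"
    unfolding e_def using U.eval_monom1[OF assms(4)] by simp
  have mono: "up_ring.monom (UP ?A) a n \<in> carrier (UP ?A)" if "a \<in> D" for a n
    using AP.monom_closed[of a n] that by simp
  have "D \<subseteq> ?D" using const mono by (metis image_eqI subsetI)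
  moreover have "x \<in> ?D" using X mono[of "\<one>\<^bsub>R\<^esub>" 1] subringE(3)[OF assms(2)] by (metis image_eqI)
  moreover have "unit_specializable ?B"
  proof -
    have eB: "e \<in> ring_hom (UP ?A) ?B" using e by (auto simp: ring_hom_def)
    show ?thesis
    proof (cases "\<exists>f\<in>carrier (UP ?A). f \<noteq> \<zero>\<^bsub>UP ?A\<^esub> \<and> e f = \<zero>\<^bsub>R\<^esub>")
      case True
      then show ?thesis
        using const
        by (intro unit_specializable_adjoin_algebraic[OF A.domain_axioms B.domain_axioms eB _ _ assms(3)]) auto
    next
      case False
      then show ?thesis
        by (intro unit_specializable_adjoin_transcendental[OF A.domain_axioms B.domain_axioms eB _ assms(3)]) auto
    qed
  qed
  ultimately show ?thesis using sub that by blast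
qed

lemma finite_subset_unit_specializable:
  assumes "domain R" "finite E" "E \<subseteq> carrier R"
  obtains D where "subring D R" "E \<subseteq> D" "unit_specializable (R\<lparr>carrier := D\<rparr>)"
proof -
  have "\<exists>D. subring D R \<and> E \<subseteq> D \<and> unit_specializable (R\<lparr>carrier := D\<rparr>)"
    using assms(2,3)
  proof induction
    case empty
    then show ?case using unit_specializable_prime_subring[OF assms(1)] by (metis empty_subsetI)
  next
    case (insert x E)
    then obtain D where D: "subring D R" "E \<subseteq> D" "unit_specializable (R\<lparr>carrier := D\<rparr>)" by auto
    obtain D' where "subring D' R" "D \<subseteq> D'" "x \<in> D'" "unit_specializable (R\<lparr>carrier := D'\<rparr>)"
      using unit_specializable_adjoin[OF assms(1) D(1,3)] insert.prems by blast
    then show ?case using D(2) by (intro exI[of _ D']) auto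
  qed
  then show ?thesis using that by blast
qed

text \<open>Multiplying the elements together gives such a \<open>d\<close>, nonzero for lack of
  zero divisors. One element then controls a whole finite set: a homomorphism that does not kill
  \<open>d\<close> kills no member of \<open>S\<close>.\<close>

lemma (in domain) common_nonzero_multiple:
  assumes "finite S" "S \<subseteq> carrier R - {\<zero>}"
  shows "\<exists>d\<in>carrier R. d \<noteq> \<zero> \<and> (\<forall>s\<in>S. \<exists>t\<in>carrier R. d = s \<otimes> t)"
  using assms
proof induction
  case empty
  then show ?case by (auto intro!: bexI[of _ \<one>])
next
  case (insert a S)
  then obtain d where d: "d \<in> carrier R" "d \<noteq> \<zero>" "\<And>s. s \<in> S \<Longrightarrow> \<exists>t\<in>carrier R. d = s \<otimes> t" by auto
  have a: "a \<in> carrier R" "a \<noteq> \<zero>" using insert.prems by auto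
  have "\<exists>t\<in>carrier R. a \<otimes> d = s \<otimes> t" if "s \<in> insert a S" for s
  proof (cases "s = a")
    case True
    then show ?thesis using d(1) by blast
  next
    case False
    then have "s \<in> S" using that by simp
    from d(3)[OF this] obtain t where t: "t \<in> carrier R" "d = s \<otimes> t" ..
    have "s \<in> carrier R" using \<open>s \<in> S\<close> insert.prems by auto
    then have "a \<otimes> d = s \<otimes> (a \<otimes> t)" using a t m_lcomm by simp
    then show ?thesis using a t by (intro bexI[of _ "a \<otimes> t"]) simp_all
  qed
  moreover have "a \<otimes> d \<noteq> \<zero>" using a d by (simp add: integral_iff)
  moreover have "a \<otimes> d \<in> carrier R" using a d by simp
  ultimately show ?case by blast
qed

lemma domain_finite_subset_hom:
  assumes "domain R" "finite E" "E \<subseteq> carrier R"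
  obtains D and K :: "nat ring" and \<phi> where "subring D R" "E \<subseteq> D" "cring K" "finite (carrier K)"
    "\<phi> \<in> ring_hom (R\<lparr>carrier := D\<rparr>) K" "inj_on \<phi> E"
proof -
  obtain D where D: "subring D R" "E \<subseteq> D" "unit_specializable (R\<lparr>carrier := D\<rparr>)"
    using finite_subset_unit_specializable[OF assms] .
  let ?A = "R\<lparr>carrier := D\<rparr>"
  interpret A: domain ?A using domain.subring_is_domain[OF assms(1) D(1)] .
  let ?S = "(\<lambda>(x, y). x \<ominus>\<^bsub>?A\<^esub> y) ` {p \<in> E \<times> E. fst p \<noteq> snd p}"
  have EA: "E \<subseteq> carrier ?A" using D(2) by simp
  have "?S \<subseteq> carrier ?A - {\<zero>\<^bsub>?A\<^esub>}"
  proof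
    fix s assume "s \<in> ?S"
    then obtain x y where s: "s = x \<ominus>\<^bsub>?A\<^esub> y" and xyE: "x \<in> E" "y \<in> E" and ne: "x \<noteq> y" by auto
    have xy: "x \<in> carrier ?A" "y \<in> carrier ?A" using xyE EA by blast+
    have "s \<in> carrier ?A" unfolding s by (rule A.minus_closed[OF xy])
    moreover have "s \<noteq> \<zero>\<^bsub>?A\<^esub>" unfolding s using A.r_right_minus_eq[OF xy] ne by blast
    ultimately show "s \<in> carrier ?A - {\<zero>\<^bsub>?A\<^esub>}" by blast
  qed
  moreover have "finite ?S" using assms(2) by auto
  ultimately obtain d where d: "d \<in> carrier ?A" "d \<noteq> \<zero>\<^bsub>?A\<^esub>"
    "\<And>s. s \<in> ?S \<Longrightarrow> \<exists>t\<in>carrier ?A. d = s \<otimes>\<^bsub>?A\<^esub> t"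
    using A.common_nonzero_multiple[of ?S] by blast
  obtain K :: "nat ring" and \<phi> where K: "cring K" "finite (carrier K)" "\<one>\<^bsub>K\<^esub> \<noteq> \<zero>\<^bsub>K\<^esub>"
    and \<phi>: "\<phi> \<in> ring_hom ?A K" "\<phi> d \<in> Units K"
    using D(3) d(1,2) unfolding unit_specializable_def by blast
  interpret K: cring K by fact
  interpret \<phi>: ring_hom_ring ?A K \<phi> using \<phi>(1) by (intro ring_hom_ringI2 A.ring_axioms K.ring_axioms)
  have "inj_on \<phi> E"
  \<comment> \<open>Identifying \<open>x\<close> and \<open>y\<close> would kill their difference,
    hence its multiple \<open>d\<close>; but the image of \<open>d\<close> is a unit of a nonzero
    ring.\<close>
  proof (rule inj_onI, rule ccontr)
    fix x y assume xy: "x \<in> E" "y \<in> E" "\<phi> x = \<phi> y" "x \<noteq> y"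
    then have xyA: "x \<in> carrier ?A" "y \<in> carrier ?A" using EA by auto
    have "x \<ominus>\<^bsub>?A\<^esub> y \<in> ?S" using xy by force
    then obtain t where t: "t \<in> carrier ?A" "d = (x \<ominus>\<^bsub>?A\<^esub> y) \<otimes>\<^bsub>?A\<^esub> t" using d(3) by blast
    have "\<phi> (x \<ominus>\<^bsub>?A\<^esub> y) = \<phi> x \<ominus>\<^bsub>K\<^esub> \<phi> y"
      unfolding a_minus_def using \<phi>.hom_add[OF xyA(1) A.a_inv_closed[OF xyA(2)]] \<phi>.hom_a_inv[OF xyA(2)] by simp
    also have "\<dots> = \<zero>\<^bsub>K\<^esub>" using xy(3) \<phi>.hom_closed[OF xyA(2)] by (simp add: K.r_right_minus_eq)
    finally have "\<phi> d = \<zero>\<^bsub>K\<^esub> \<otimes>\<^bsub>K\<^esub> \<phi> t"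
      using t \<phi>.hom_mult[OF A.minus_closed[OF xyA] t(1)] by simp
    then have "\<zero>\<^bsub>K\<^esub> \<in> Units K" using \<phi>(2) \<phi>.hom_closed[OF t(1)] by simp
    then show False using K(3) K.Units_r_inv[of "\<zero>\<^bsub>K\<^esub>"] K.l_null K.Units_inv_closed by metis
  qed
  with D(1,2) K \<phi>(1) that show ?thesis by blast
qed

section \<open>Automorphisms of free modules\<close>

text \<open>The finite group may live on any type, as it can be copied to \<open>nat\<close>. This
  admits permutation groups of function spaces and direct products as witnesses.\<close>

lemma LEF_groupI:
  assumes "group G"
    and "\<And>A. finite A \<Longrightarrow> A \<subseteq> carrier G \<Longrightarrow>
      \<exists>(Q :: 'q monoid) \<phi>. group Q \<and> finite (carrier Q) \<and> \<phi> \<in> A \<rightarrow> carrier Q \<and> inj_on \<phi> A \<and>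
        (\<forall>g\<in>A. \<forall>h\<in>A. g \<otimes>\<^bsub>G\<^esub> h \<in> A \<longrightarrow> \<phi> (g \<otimes>\<^bsub>G\<^esub> h) = \<phi> g \<otimes>\<^bsub>Q\<^esub> \<phi> h)"
  shows "LEF_group G"
  unfolding LEF_group_def
proof (intro conjI allI impI assms(1))
  fix A assume "finite A \<and> A \<subseteq> carrier G"
  then obtain Q :: "'q monoid" and \<phi> where Q: "group Q" "finite (carrier Q)" and \<phi>: "\<phi> \<in> A \<rightarrow> carrier Q"
    "inj_on \<phi> A" "\<And>g h. g \<in> A \<Longrightarrow> h \<in> A \<Longrightarrow> g \<otimes>\<^bsub>G\<^esub> h \<in> A \<Longrightarrow> \<phi> (g \<otimes>\<^bsub>G\<^esub> h) = \<phi> g \<otimes>\<^bsub>Q\<^esub> \<phi> h"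
    using assms(2) by metis
  obtain L :: "nat monoid" and f where L: "group L" "finite (carrier L)" "f \<in> iso Q L"
    using finite_group_nat_copy[OF Q] .
  have f: "f \<in> hom Q L" "inj_on f (carrier Q)" using L(3) by (auto simp: iso_def bij_betw_def)
  have "f \<circ> \<phi> \<in> A \<rightarrow> carrier L" using f(1) \<phi>(1) by (auto simp: hom_def)
  moreover have "inj_on (f \<circ> \<phi>) A"
    using \<phi>(1) by (intro comp_inj_on \<phi>(2) inj_on_subset[OF f(2)]) auto
  moreover have "(f \<circ> \<phi>) (g \<otimes>\<^bsub>G\<^esub> h) = (f \<circ> \<phi>) g \<otimes>\<^bsub>L\<^esub> (f \<circ> \<phi>) h" if "g \<in> A" "h \<in> A" "g \<otimes>\<^bsub>G\<^esub> h \<in> A" for g h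
    using \<phi>(3)[OF that] hom_mult[OF f(1)] \<phi>(1) that by (auto simp: Pi_def)
  ultimately show "\<exists>(Q :: nat monoid) \<phi>. group Q \<and> finite (carrier Q) \<and> \<phi> \<in> A \<rightarrow> carrier Q \<and> inj_on \<phi> A \<and>
        (\<forall>g\<in>A. \<forall>h\<in>A. g \<otimes>\<^bsub>G\<^esub> h \<in> A \<longrightarrow> \<phi> (g \<otimes>\<^bsub>G\<^esub> h) = \<phi> g \<otimes>\<^bsub>Q\<^esub> \<phi> h)"
    using L(1,2) by blast
qed

lemma group_mod_auto_group:
  assumes "module R M"
  shows "group (mod_auto_group R M)"
proof -
  interpret module R M by fact
  interpret B: group "BijGroup (carrier M)" by (rule group_BijGroup)
  let ?H = "mod_hom R M M \<inter> Bij (carrier M)"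
  have "subgroup ?H (BijGroup (carrier M))"
  proof (rule B.subgroupI)
    show "?H \<subseteq> carrier (BijGroup (carrier M))" by (simp add: BijGroup_def)
    have "(\<lambda>x\<in>carrier M. x) \<in> ?H" by (auto simp: mod_hom_def id_Bij)
    then show "?H \<noteq> {}" by blast
  next
    fix f assume f: "f \<in> ?H"
    let ?g = "inv_into (carrier M) f"
    have fB: "f \<in> Bij (carrier M)" using f by simp
    have bij: "bij_betw f (carrier M) (carrier M)" using f by (simp add: Bij_def)
    have cl: "?g x \<in> carrier M" "f (?g x) = x" if "x \<in> carrier M" for x
      using that bij by (auto simp: bij_betw_def intro: inv_into_into f_inv_into_f)
    have eqI: "?g x = y" if "x \<in> carrier M" "y \<in> carrier M" "f y = x" for x y
      using that bij by (auto simp: bij_betw_def inv_into_f_f)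
    have "restrict ?g (carrier M) \<in> ?H"
      using f cl restrict_inv_into_Bij[OF fB] by (auto simp: mod_hom_def intro!: eqI)
    then show "inv\<^bsub>BijGroup (carrier M)\<^esub> f \<in> ?H" using inv_BijGroup[OF fB] by simp
  next
    fix f g assume fg: "f \<in> ?H" "g \<in> ?H"
    then have "compose (carrier M) f g \<in> ?H"
      by (auto simp: mod_hom_def compose_def Pi_def intro: compose_Bij[unfolded compose_def])
    then show "f \<otimes>\<^bsub>BijGroup (carrier M)\<^esub> g \<in> ?H" using fg by (simp add: BijGroup_def)
  qed
  then show ?thesis
    unfolding mod_auto_group_def by (rule subgroup.subgroup_is_group) (rule B.group_axioms)
qed

lemma carrier_mod_auto_group: "carrier (mod_auto_group R M) = mod_hom R M M \<inter> Bij (carrier M)"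
  by (simp add: mod_auto_group_def)

lemma mod_auto_group_closed:
  "A \<in> carrier (mod_auto_group R M) \<Longrightarrow> f \<in> carrier M \<Longrightarrow> A f \<in> carrier M"
  by (auto simp: carrier_mod_auto_group mod_hom_def)

lemma mod_auto_group_mult:
  assumes "A \<in> carrier (mod_auto_group R M)" "B \<in> carrier (mod_auto_group R M)" "f \<in> carrier M"
  shows "(A \<otimes>\<^bsub>mod_auto_group R M\<^esub> B) f = A (B f)"
  using assms by (simp add: mod_auto_group_def BijGroup_def compose_def)

lemma mod_auto_group_one: "f \<in> carrier M \<Longrightarrow> \<one>\<^bsub>mod_auto_group R M\<^esub> f = f"
  by (simp add: mod_auto_group_def BijGroup_def)

lemma mod_auto_group_eqI:
  assumes "A \<in> carrier (mod_auto_group R M)" "B \<in> carrier (mod_auto_group R M)"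
    and "\<And>f. f \<in> carrier M \<Longrightarrow> A f = B f"
  shows "A = B"
  using assms by (intro extensionalityI[of A "carrier M" B]) (auto simp: carrier_mod_auto_group Bij_def)

lemma mod_auto_group_inv:
  assumes "module R M" "A \<in> carrier (mod_auto_group R M)" "f \<in> carrier M"
  shows "A ((inv\<^bsub>mod_auto_group R M\<^esub> A) f) = f" "(inv\<^bsub>mod_auto_group R M\<^esub> A) (A f) = f"
proof -
  interpret group "mod_auto_group R M" by (rule group_mod_auto_group[OF assms(1)])
  show "A ((inv\<^bsub>mod_auto_group R M\<^esub> A) f) = f"
    using mod_auto_group_mult[OF assms(2) inv_closed[OF assms(2)] assms(3)] assms
    by (simp add: mod_auto_group_one)
  show "(inv\<^bsub>mod_auto_group R M\<^esub> A) (A f) = f"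
    using mod_auto_group_mult[OF inv_closed[OF assms(2)] assms(2,3)] assms
    by (simp add: mod_auto_group_one)
qed

lemma mod_auto_groupI:
  assumes "A \<in> extensional (carrier M)" "A \<in> mod_hom R M M" "B \<in> carrier M \<rightarrow> carrier M"
    and "\<And>f. f \<in> carrier M \<Longrightarrow> A (B f) = f" "\<And>f. f \<in> carrier M \<Longrightarrow> B (A f) = f"
  shows "A \<in> carrier (mod_auto_group R M)"
proof -
  have "A \<in> carrier M \<rightarrow> carrier M" using assms(2) by (simp add: mod_hom_def)
  then have "bij_betw A (carrier M) (carrier M)"
    using assms(3-5) by (intro bij_betwI[of A _ _ B]) auto
  then show ?thesis using assms(1,2) by (simp add: carrier_mod_auto_group Bij_def)
qed

lemma free_module_mem_iff:
  "f \<in> carrier (free_module R S) \<longleftrightarrow>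
    (\<forall>x. f x \<in> carrier R) \<and> (\<forall>x. x \<notin> S \<longrightarrow> f x = \<zero>\<^bsub>R\<^esub>) \<and> finite {x. f x \<noteq> \<zero>\<^bsub>R\<^esub>}"
  by (simp add: free_module_def)

lemma free_module_add [simp]: "f \<oplus>\<^bsub>free_module R S\<^esub> g = (\<lambda>x. f x \<oplus>\<^bsub>R\<^esub> g x)"
  by (simp add: free_module_def)

lemma free_module_smult [simp]: "a \<odot>\<^bsub>free_module R S\<^esub> f = (\<lambda>x. a \<otimes>\<^bsub>R\<^esub> f x)"
  by (simp add: free_module_def)

lemma free_module_mono: "Z \<subseteq> S \<Longrightarrow> f \<in> carrier (free_module R Z) \<Longrightarrow> f \<in> carrier (free_module R S)"
  by (auto simp: free_module_mem_iff)

lemma Aut_free_add: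
  assumes "A \<in> carrier (Aut_free R S)" "f \<in> carrier (free_module R S)" "g \<in> carrier (free_module R S)"
  shows "A (\<lambda>x. f x \<oplus>\<^bsub>R\<^esub> g x) = (\<lambda>x. A f x \<oplus>\<^bsub>R\<^esub> A g x)"
  using assms by (auto simp: carrier_mod_auto_group mod_hom_def)

lemma Aut_free_smult:
  assumes "A \<in> carrier (Aut_free R S)" "f \<in> carrier (free_module R S)" "a \<in> carrier R"
  shows "A (\<lambda>x. a \<otimes>\<^bsub>R\<^esub> f x) = (\<lambda>x. a \<otimes>\<^bsub>R\<^esub> A f x)"
  using assms by (auto simp: carrier_mod_auto_group mod_hom_def)

section \<open>Automorphisms supported on a given set\<close>

definition supp_restrict :: "('r, 'm) ring_scheme \<Rightarrow> 'x set \<Rightarrow> ('x \<Rightarrow> 'r) \<Rightarrow> 'x \<Rightarrow> 'r" where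
  "supp_restrict R W f = (\<lambda>x. if x \<in> W then f x else \<zero>\<^bsub>R\<^esub>)"

text \<open>\<open>GL_f\<close> is the directed union of these subgroups over finite
  \<open>Z\<close>. With the support named it can be enlarged, translated by the action and moved
  along an injection.\<close>

definition supported_Aut :: "('r, 'm) ring_scheme \<Rightarrow> 'x set \<Rightarrow> 'x set \<Rightarrow> (('x \<Rightarrow> 'r) \<Rightarrow> ('x \<Rightarrow> 'r)) set" where
  "supported_Aut R S Z = {A \<in> carrier (Aut_free R S).
     A ` carrier (free_module R Z) \<subseteq> carrier (free_module R Z) \<and>
     (\<forall>x\<in>S - Z. A (basis_vec R x) = basis_vec R x)}"

context cring
begin

lemma supp_restrict_closed:
  assumes "f \<in> carrier (free_module R S)"
  shows "supp_restrict R W f \<in> carrier (free_module R (S \<inter> W))"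
proof -
  have "{x. supp_restrict R W f x \<noteq> \<zero>} \<subseteq> {x. f x \<noteq> \<zero>}" by (auto simp: supp_restrict_def)
  then show ?thesis
    using assms by (auto simp: free_module_mem_iff supp_restrict_def intro: finite_subset)
qed

lemma supp_restrict_closed':
  assumes "f \<in> carrier (free_module R S)"
  shows "supp_restrict R W f \<in> carrier (free_module R S)"
  using supp_restrict_closed[OF assms] by (rule free_module_mono[rotated]) simp

lemma basis_vec_closed: "x \<in> S \<Longrightarrow> basis_vec R x \<in> carrier (free_module R S)"
  by (rule basis_vec_in_free_module[OF is_cring])

lemma smult_basis_vec_closed:
  "x \<in> S \<Longrightarrow> a \<in> carrier R \<Longrightarrow> (\<lambda>y. a \<otimes> basis_vec R x y) \<in> carrier (free_module R S)"
  using module.smult_closed[OF module_free_module[OF is_cring] _ basis_vec_closed] by simp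

text \<open>Adds the coordinates of \<open>f\<close> one at a time. Only truncations of the same
  \<open>f\<close> occur, so a property of its coordinates, such as lying in a subring or in a
  kernel, is available in every step without being carried in \<open>P\<close>.\<close>

lemma free_module_induct [consumes 1, case_names zero step]:
  assumes f: "f \<in> carrier (free_module R S)"
    and zero: "P (\<lambda>x. \<zero>)"
    and step: "\<And>W x. finite W \<Longrightarrow> x \<notin> W \<Longrightarrow> x \<in> S \<Longrightarrow> P (supp_restrict R W f) \<Longrightarrow>
      P (\<lambda>y. supp_restrict R W f y \<oplus> f x \<otimes> basis_vec R x y)"
  shows "P f"
proof -
  have fR: "f x \<in> carrier R" for x using f by (simp add: free_module_mem_iff)
  have "P (supp_restrict R W f)" if "finite W" "W \<subseteq> S" for W
    using that
  proof induction
    case empty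
    then show ?case using zero by (simp add: supp_restrict_def)
  next
    case (insert x W)
    have "supp_restrict R (insert x W) f = (\<lambda>y. supp_restrict R W f y \<oplus> f x \<otimes> basis_vec R x y)"
      using insert.hyps fR by (auto simp: supp_restrict_def basis_vec_def)
    then show ?case using step[of W x] insert by simp
  qed
  moreover have "supp_restrict R {x. f x \<noteq> \<zero>} f = f" by (auto simp: supp_restrict_def)
  moreover have "finite {x. f x \<noteq> \<zero>}" "{x. f x \<noteq> \<zero>} \<subseteq> S" using f by (auto simp: free_module_mem_iff)
  ultimately show ?thesis by metis
qed

lemma Aut_free_step:
  assumes "A \<in> carrier (Aut_free R S)" "f \<in> carrier (free_module R S)" "x \<in> S"
  shows "A (\<lambda>y. supp_restrict R W f y \<oplus> f x \<otimes> basis_vec R x y) =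
    (\<lambda>y. A (supp_restrict R W f) y \<oplus> f x \<otimes> A (basis_vec R x) y)"
proof -
  have fx: "f x \<in> carrier R" using assms(2) by (simp add: free_module_mem_iff)
  show ?thesis
    using Aut_free_add[OF assms(1) supp_restrict_closed'[OF assms(2)] smult_basis_vec_closed[OF assms(3) fx]]
      Aut_free_smult[OF assms(1) basis_vec_closed[OF assms(3)] fx] by simp
qed

lemma Aut_free_zero:
  assumes "A \<in> carrier (Aut_free R S)"
  shows "A (\<lambda>x. \<zero>) = (\<lambda>x. \<zero>)"
proof -
  have z: "(\<lambda>x. \<zero>) \<in> carrier (free_module R S)" by (simp add: free_module_mem_iff)
  then have "A (\<lambda>x. \<zero>) y \<in> carrier R" for y
    using mod_auto_group_closed[OF assms z] by (simp add: free_module_mem_iff)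
  then show ?thesis using Aut_free_smult[OF assms z zero_closed] by simp
qed

lemma Aut_free_eq_onI:
  assumes A: "A \<in> carrier (Aut_free R S)" and B: "B \<in> carrier (Aut_free R S)" and "T \<subseteq> S"
    and eq: "\<And>x. x \<in> T \<Longrightarrow> A (basis_vec R x) = B (basis_vec R x)"
    and "f \<in> carrier (free_module R T)"
  shows "A f = B f"
  using assms(5)
proof (induction rule: free_module_induct)
  case zero
  show ?case using A B by (simp add: Aut_free_zero)
next
  case (step W x)
  have "f \<in> carrier (free_module R S)" "x \<in> S"
    using free_module_mono[OF assms(3,5)] step assms(3) by auto
  then show ?case using step eq by (simp add: Aut_free_step[OF A] Aut_free_step[OF B])
qed

lemma Aut_free_group: "group (Aut_free R S)"
  by (rule group_mod_auto_group[OF module_free_module[OF is_cring]])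

lemmas Aut_free_inv = mod_auto_group_inv[OF module_free_module[OF is_cring]]

text \<open>In block form, \<open>A\<close> is some matrix on \<open>Z\<close> and the identity off
  \<open>Z\<close>: it agrees with the identity on R[S - Z], where basis vectors determine it, and
  maps the \<open>Z\<close>-part of \<open>f\<close> back into R[Z].\<close>

lemma supported_Aut_apply:
  assumes A: "A \<in> supported_Aut R S Z" and "Z \<subseteq> S" and f: "f \<in> carrier (free_module R S)"
  shows "A f x = (if x \<in> Z then A (supp_restrict R Z f) x else f x)"
proof -
  have AA: "A \<in> carrier (Aut_free R S)" using A by (simp add: supported_Aut_def)
  interpret G: group "Aut_free R S" by (rule Aut_free_group)
  let ?g = "supp_restrict R (- Z) f"
  have g: "?g \<in> carrier (free_module R (S - Z))"
    using supp_restrict_closed[OF f, of "- Z"] by (simp add: Diff_eq)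
  have gS: "?g \<in> carrier (free_module R S)" using f by (rule supp_restrict_closed')
  have fZ: "supp_restrict R Z f \<in> carrier (free_module R Z)"
    using supp_restrict_closed[OF f, of Z] assms(2) by (simp add: Int_absorb1)
  have "A ?g = \<one>\<^bsub>Aut_free R S\<^esub> ?g"
    using A by (intro Aut_free_eq_onI[OF AA G.one_closed _ _ g])
      (auto simp: supported_Aut_def mod_auto_group_one basis_vec_closed)
  then have Ag: "A ?g = ?g" using gS by (simp add: mod_auto_group_one)
  have fR: "f x \<in> carrier R" for x using f by (simp add: free_module_mem_iff)
  then have "f = (\<lambda>x. supp_restrict R Z f x \<oplus> ?g x)" by (auto simp: supp_restrict_def)
  then have "A f = (\<lambda>x. A (supp_restrict R Z f) x \<oplus> ?g x)"
    using Aut_free_add[OF AA supp_restrict_closed'[OF f, of Z] gS] Ag by simp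
  moreover have AfZ: "A (supp_restrict R Z f) \<in> carrier (free_module R Z)"
    using A fZ by (auto simp: supported_Aut_def)
  ultimately show ?thesis using fR by (auto simp: free_module_mem_iff supp_restrict_def)
qed

lemma supported_Aut_mono:
  assumes A: "A \<in> supported_Aut R S Z" and "Z \<subseteq> Z'" "Z' \<subseteq> S"
  shows "A \<in> supported_Aut R S Z'"
proof -
  have AA: "A \<in> carrier (Aut_free R S)" using A by (simp add: supported_Aut_def)
  have "A f \<in> carrier (free_module R Z')" if f: "f \<in> carrier (free_module R Z')" for f
  proof -
    have fS: "f \<in> carrier (free_module R S)" using free_module_mono[OF assms(3) f] .
    have "A f x = \<zero>" if "x \<notin> Z'" for x
      using supported_Aut_apply[OF A _ fS, of x] that f assms by (auto simp: free_module_mem_iff)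
    then show ?thesis using mod_auto_group_closed[OF AA fS] by (simp add: free_module_mem_iff)
  qed
  then show ?thesis using A assms(2) by (auto simp: supported_Aut_def)
qed

lemma supported_Aut_subgroup:
  assumes "Z \<subseteq> S"
  shows "subgroup (supported_Aut R S Z) (Aut_free R S)"
proof -
  interpret G: group "Aut_free R S" by (rule Aut_free_group)
  show ?thesis
  proof (rule G.subgroupI)
    show "supported_Aut R S Z \<subseteq> carrier (Aut_free R S)" by (auto simp: supported_Aut_def)
    have "\<one>\<^bsub>Aut_free R S\<^esub> \<in> supported_Aut R S Z"
      using free_module_mono[OF assms, of _ R] by (auto simp: supported_Aut_def mod_auto_group_one basis_vec_closed)
    then show "supported_Aut R S Z \<noteq> {}" by blast
  next
    fix A assume A: "A \<in> supported_Aut R S Z"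
    then have AA: "A \<in> carrier (Aut_free R S)" by (simp add: supported_Aut_def)
    let ?B = "inv\<^bsub>Aut_free R S\<^esub> A"
    have B: "?B \<in> carrier (Aut_free R S)" using AA by simp
    \<comment> \<open>Here \<open>Z\<close> may be infinite, and a shift shows that mapping R[Z]
      into itself does not suffice for the inverse to do so. The coordinates off \<open>Z\<close>
      decide: \<open>A\<close> leaves them unchanged, so those of \<open>?B f\<close> equal those of
      \<open>f\<close>.\<close>
    have "?B f \<in> carrier (free_module R Z)" if f: "f \<in> carrier (free_module R Z)" for f
    proof -
      have fS: "f \<in> carrier (free_module R S)" using free_module_mono[OF assms f] .
      have BS: "?B f \<in> carrier (free_module R S)" using mod_auto_group_closed[OF B fS] .
      have "?B f x = \<zero>" if "x \<notin> Z" for x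
        using supported_Aut_apply[OF A assms BS, of x] that f Aut_free_inv(1)[OF AA fS]
        by (simp add: free_module_mem_iff)
      then show ?thesis using BS by (simp add: free_module_mem_iff)
    qed
    moreover have "?B (basis_vec R x) = basis_vec R x" if "x \<in> S - Z" for x
      using Aut_free_inv(2)[OF AA basis_vec_closed, of x] that A by (simp add: supported_Aut_def)
    ultimately show "?B \<in> supported_Aut R S Z" using B by (auto simp: supported_Aut_def)
  next
    fix A B assume AB: "A \<in> supported_Aut R S Z" "B \<in> supported_Aut R S Z"
    then have c: "A \<in> carrier (Aut_free R S)" "B \<in> carrier (Aut_free R S)" by (auto simp: supported_Aut_def)
    have "(A \<otimes>\<^bsub>Aut_free R S\<^esub> B) f \<in> carrier (free_module R Z)" if f: "f \<in> carrier (free_module R Z)" for f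
    proof -
      have "A (B f) \<in> carrier (free_module R Z)" using AB f unfolding supported_Aut_def by blast
      then show ?thesis using mod_auto_group_mult[OF c free_module_mono[OF assms f]] by simp
    qed
    moreover have "(A \<otimes>\<^bsub>Aut_free R S\<^esub> B) (basis_vec R x) = basis_vec R x" if "x \<in> S - Z" for x
      using mod_auto_group_mult[OF c basis_vec_closed, of x] AB that by (auto simp: supported_Aut_def)
    ultimately show "A \<otimes>\<^bsub>Aut_free R S\<^esub> B \<in> supported_Aut R S Z" using c by (auto simp: supported_Aut_def)
  qed
qed

lemma supported_Aut_eqI:
  assumes AB: "A \<in> supported_Aut R S Z" "B \<in> supported_Aut R S Z" and "Z \<subseteq> S"
    and eq: "\<And>f. f \<in> carrier (free_module R Z) \<Longrightarrow> A f = B f"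
  shows "A = B"
proof (rule mod_auto_group_eqI)
  show "A \<in> carrier (Aut_free R S)" "B \<in> carrier (Aut_free R S)" using AB by (auto simp: supported_Aut_def)
  fix f assume f: "f \<in> carrier (free_module R S)"
  have fZ: "supp_restrict R Z f \<in> carrier (free_module R Z)"
    using supp_restrict_closed[OF f, of Z] assms(3) by (simp add: Int_absorb1)
  show "A f = B f"
    using supported_Aut_apply[OF AB(1) assms(3) f] supported_Aut_apply[OF AB(2) assms(3) f] eq[OF fZ] by auto
qed

lemma carrier_GL_f: "carrier (GL_f S R) = (\<Union>Z\<in>{Z. finite Z \<and> Z \<subseteq> S}. supported_Aut R S Z)"
  by (auto simp: GL_f_def supported_Aut_def)

lemma GL_f_subgroup: "subgroup (carrier (GL_f S R)) (Aut_free R S)"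
proof -
  interpret G: group "Aut_free R S" by (rule Aut_free_group)
  show ?thesis
    unfolding carrier_GL_f
  proof (rule G.subgroupI)
    show "(\<Union>Z\<in>{Z. finite Z \<and> Z \<subseteq> S}. supported_Aut R S Z) \<subseteq> carrier (Aut_free R S)"
      by (auto simp: supported_Aut_def)
    show "(\<Union>Z\<in>{Z. finite Z \<and> Z \<subseteq> S}. supported_Aut R S Z) \<noteq> {}"
      using subgroup.one_closed[OF supported_Aut_subgroup[of "{}" S]] by blast
  next
    fix A assume "A \<in> (\<Union>Z\<in>{Z. finite Z \<and> Z \<subseteq> S}. supported_Aut R S Z)"
    then show "inv\<^bsub>Aut_free R S\<^esub> A \<in> (\<Union>Z\<in>{Z. finite Z \<and> Z \<subseteq> S}. supported_Aut R S Z)"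
      using subgroup.m_inv_closed[OF supported_Aut_subgroup] by blast
  next
    fix A B assume "A \<in> (\<Union>Z\<in>{Z. finite Z \<and> Z \<subseteq> S}. supported_Aut R S Z)"
      "B \<in> (\<Union>Z\<in>{Z. finite Z \<and> Z \<subseteq> S}. supported_Aut R S Z)"
    then obtain Z W where ZW: "finite Z" "Z \<subseteq> S" "finite W" "W \<subseteq> S"
      and "A \<in> supported_Aut R S Z" "B \<in> supported_Aut R S W" by blast
    then have AB: "A \<in> supported_Aut R S (Z \<union> W)" "B \<in> supported_Aut R S (Z \<union> W)"
      by (auto intro: supported_Aut_mono)
    have "Z \<union> W \<subseteq> S" using ZW by simp
    from subgroup.m_closed[OF supported_Aut_subgroup[OF this] AB]
    have "A \<otimes>\<^bsub>Aut_free R S\<^esub> B \<in> supported_Aut R S (Z \<union> W)" .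
    then show "A \<otimes>\<^bsub>Aut_free R S\<^esub> B \<in> (\<Union>Z\<in>{Z. finite Z \<and> Z \<subseteq> S}. supported_Aut R S Z)"
      using ZW by blast
  qed
qed

end

section \<open>Integral domains\<close>

text \<open>
  The action induced by \<open>A\<close> on the image of \<open>D[Z]\<close> in \<open>K[Z]\<close> under \<open>\<phi> : D \<rightarrow> K\<close>. The choice of a preimage
  is harmless when \<open>A\<close> has entries in \<open>D\<close>, for then \<open>A\<close> preserves both \<open>D[Z]\<close> and the
  vectors with coordinates in the kernel of \<open>\<phi>\<close>.
\<close>

definition scalar_extend ::
  "('r, 'm) ring_scheme \<Rightarrow> 'x set \<Rightarrow> 'r set \<Rightarrow> ('r \<Rightarrow> 'k) \<Rightarrow> (('x \<Rightarrow> 'r) \<Rightarrow> ('x \<Rightarrow> 'r)) \<Rightarrow>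
    ('x \<Rightarrow> 'k) \<Rightarrow> ('x \<Rightarrow> 'k)" where
  "scalar_extend R Z D \<phi> A =
     (let V = {f \<in> carrier (free_module R Z). \<forall>x. f x \<in> D}; c = (\<lambda>f. \<phi> \<circ> f) in
      restrict (\<lambda>u. \<phi> \<circ> A (inv_into V c u)) (c ` V))"

context cring
begin

lemma Aut_free_integral:
  assumes "subring D R" "A \<in> carrier (Aut_free R Z)"
    and ent: "\<And>z w. z \<in> Z \<Longrightarrow> A (basis_vec R z) w \<in> D"
    and f: "f \<in> carrier (free_module R Z)" "\<And>x. f x \<in> D"
  shows "A f w \<in> D"
proof -
  have "\<forall>w. A f w \<in> D"
    using f(1)
  proof (induction rule: free_module_induct)
    case zero
    show ?case using subringE(2)[OF assms(1)] by (simp add: Aut_free_zero[OF assms(2)])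
  next
    case (step W x)
    then show ?case
      using ent f(2) subringE(6,7)[OF assms(1)] by (simp add: Aut_free_step[OF assms(2) f(1)])
  qed
  then show ?thesis by blast
qed

text \<open>By additivity it is enough to treat the difference of \<open>f\<close> and
  \<open>g\<close>, whose coordinates lie in the kernel of \<open>\<phi>\<close>; applying entries
  from \<open>D\<close> keeps them there. This makes \<open>scalar_extend\<close> independent of the
  chosen preimage.\<close>

lemma Aut_free_integral_kernel:
  assumes "subring D R" "cring K" "\<phi> \<in> ring_hom (R\<lparr>carrier := D\<rparr>) K"
    and A: "A \<in> carrier (Aut_free R Z)"
    and ent: "\<And>z w. z \<in> Z \<Longrightarrow> A (basis_vec R z) w \<in> D"
    and f: "f \<in> carrier (free_module R Z)" "\<And>x. f x \<in> D"
    and g: "g \<in> carrier (free_module R Z)" "\<And>x. g x \<in> D"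
    and eq: "\<phi> \<circ> f = \<phi> \<circ> g"
  shows "\<phi> \<circ> A f = \<phi> \<circ> A g"
proof -
  interpret K: cring K by fact
  interpret \<phi>: ring_hom_ring "R\<lparr>carrier := D\<rparr>" K \<phi>
    using assms(3) by (intro ring_hom_ringI2 subring_is_ring[OF assms(1)] K.ring_axioms)
  have z: "\<phi> \<zero> = \<zero>\<^bsub>K\<^esub>" using \<phi>.hom_zero by simp
  have DR: "D \<subseteq> carrier R" by (rule subringE(1)[OF assms(1)])
  have cl: "x \<oplus> y \<in> D" "x \<otimes> y \<in> D" "\<ominus> x \<in> D" if "x \<in> D" "y \<in> D" for x y
    using that subringE(5,6,7)[OF assms(1)] by auto
  have add: "\<phi> (x \<oplus> y) = \<phi> x \<oplus>\<^bsub>K\<^esub> \<phi> y" if "x \<in> D" "y \<in> D" for x y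
    using \<phi>.hom_add[of x y] that by simp
  have mult: "\<phi> (x \<otimes> y) = \<phi> x \<otimes>\<^bsub>K\<^esub> \<phi> y" if "x \<in> D" "y \<in> D" for x y
    using \<phi>.hom_mult[of x y] that by simp
  have closed: "\<phi> x \<in> carrier K" if "x \<in> D" for x using \<phi>.hom_closed[of x] that by simp
  define h where "h = (\<lambda>x. f x \<oplus> \<ominus> g x)"
  have gR: "g x \<in> carrier R" for x using g DR by blast
  have fR: "f x \<in> carrier R" for x using f DR by blast
  have hM: "h \<in> carrier (free_module R Z)"
  proof -
    have "{x. h x \<noteq> \<zero>} \<subseteq> {x. f x \<noteq> \<zero>} \<union> {x. g x \<noteq> \<zero>}" by (auto simp: h_def)
    then show ?thesis
      using f g by (auto simp: free_module_mem_iff h_def intro: finite_subset)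
  qed
  have hD: "h x \<in> D" for x unfolding h_def using f g cl by blast
  have h0: "\<phi> (h x) = \<zero>\<^bsub>K\<^esub>" for x
  proof -
    have "h x \<oplus> g x = f x" using fR gR by (simp add: h_def a_assoc l_neg)
    then have "\<phi> (h x) \<oplus>\<^bsub>K\<^esub> \<phi> (g x) = \<phi> (g x)" using add[OF hD g(2), of x x] fun_cong[OF eq, of x] by simp
    then show ?thesis using closed[OF hD[of x]] closed[OF g(2)[of x]] by simp
  qed
  have Ah: "\<forall>w. A h w \<in> D \<and> \<phi> (A h w) = \<zero>\<^bsub>K\<^esub>"
    using hM
  proof (induction rule: free_module_induct)
    case zero
    show ?case using subringE(2)[OF assms(1)] z by (simp add: Aut_free_zero[OF A])
  next
    case (step W x)
    show ?case
    proof
      fix w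
      have "A (basis_vec R x) w \<in> D" using ent step by blast
      then show "A (\<lambda>y. supp_restrict R W h y \<oplus> h x \<otimes> basis_vec R x y) w \<in> D \<and>
          \<phi> (A (\<lambda>y. supp_restrict R W h y \<oplus> h x \<otimes> basis_vec R x y) w) = \<zero>\<^bsub>K\<^esub>"
        using step hD h0 cl closed by (simp add: Aut_free_step[OF A hM] add mult)
    qed
  qed
  have "f = (\<lambda>x. h x \<oplus> g x)" using fR gR by (simp add: h_def a_assoc l_neg)
  then have Af: "A f = (\<lambda>x. A h x \<oplus> A g x)" using Aut_free_add[OF A hM g(1)] by simp
  have "A g w \<in> D" for w using Aut_free_integral[OF assms(1) A ent g] .
  then show ?thesis using Ah closed by (simp add: fun_eq_iff Af add)
qed

end

text \<open>The finite group is the full symmetric group of the reduced vectors rather than a matrix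
  group over \<open>K\<close>: linearity of the reduced maps then never has to be checked, and the
  elements of \<open>K\<close> outside the image of \<open>\<phi>\<close> do not matter.\<close>

lemma LEF_group_Aut_free_domain:
  fixes R :: "('r, 'm) ring_scheme" and Z :: "'x set"
  assumes "domain R" "finite Z"
  shows "LEF_group (Aut_free R Z)"
proof (rule LEF_groupI[where 'q = "('x \<Rightarrow> nat) \<Rightarrow> ('x \<Rightarrow> nat)"])
  interpret domain R by fact
  show G: "group (Aut_free R Z)" by (rule Aut_free_group)
  interpret G: group "Aut_free R Z" by (rule G)
  fix H assume H: "finite H" "H \<subseteq> carrier (Aut_free R Z)"
  \<comment> \<open>With the inverses included, the reduction of the inverse is available and
    inverts the reduction of \<open>A\<close>.\<close>
  define H2 where "H2 = H \<union> m_inv (Aut_free R Z) ` H"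
  have "finite H2" using H by (simp add: H2_def)
  have HA: "A \<in> carrier (Aut_free R Z)" if "A \<in> H2" for A
    using that H(2) by (auto simp: H2_def)
  have HH2: "A \<in> H2" "inv\<^bsub>Aut_free R Z\<^esub> A \<in> H2" if "A \<in> H" for A
    using that by (simp_all add: H2_def)
  define E where "E = (\<lambda>(A, z, w). A (basis_vec R z) w) ` (H2 \<times> Z \<times> Z)"
  have E: "A (basis_vec R z) w \<in> E" if "A \<in> H2" "z \<in> Z" "w \<in> Z" for A z w
    unfolding E_def using that by (intro image_eqI[of _ _ "(A, z, w)"]) simp_all
  have ZR: "A (basis_vec R z) \<in> carrier (free_module R Z)" if "A \<in> H2" "z \<in> Z" for A z
    by (rule mod_auto_group_closed[OF HA[OF that(1)] basis_vec_closed[OF that(2)]])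
  have finE: "finite E" using \<open>finite H2\<close> assms(2) unfolding E_def by simp
  have ER: "E \<subseteq> carrier R"
  proof
    fix e assume "e \<in> E"
    then obtain A z w where "A \<in> H2" "z \<in> Z" "e = A (basis_vec R z) w" by (auto simp: E_def)
    then show "e \<in> carrier R" using ZR by (simp add: free_module_mem_iff)
  qed
  obtain D and K :: "nat ring" and \<phi> where D: "subring D R" "E \<subseteq> D"
    and K: "cring K" "finite (carrier K)" and \<phi>: "\<phi> \<in> ring_hom (R\<lparr>carrier := D\<rparr>) K" "inj_on \<phi> E"
    by (rule domain_finite_subset_hom[OF assms(1) finE ER], rule that)
  define V where "V = {f \<in> carrier (free_module R Z). \<forall>x. f x \<in> D}"
  let ?X = "(\<lambda>f. \<phi> \<circ> f) ` V"
  let ?T = "scalar_extend R Z D \<phi>"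
  have ent: "A (basis_vec R z) w \<in> D" if "A \<in> H2" "z \<in> Z" for A z w
  proof (cases "w \<in> Z")
    case True
    then show ?thesis using E[OF that] D(2) by blast
  next
    case False
    then have "A (basis_vec R z) w = \<zero>\<^bsub>R\<^esub>" using ZR[OF that] by (simp add: free_module_mem_iff)
    then show ?thesis using subringE(2)[OF D(1)] by simp
  qed
  have pres: "A f \<in> V" if "A \<in> H2" "f \<in> V" for A f
    using Aut_free_integral[OF D(1) HA[OF that(1)] ent[OF that(1)]] mod_auto_group_closed[OF HA[OF that(1)]] that(2)
    by (simp add: V_def)
  have T: "?T A (\<phi> \<circ> f) = \<phi> \<circ> A f" if "A \<in> H2" "f \<in> V" for A f
  proof -
    have X: "\<phi> \<circ> f \<in> ?X" using that by blast
    let ?g = "inv_into V (\<lambda>f. \<phi> \<circ> f) (\<phi> \<circ> f)"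
    have "?g \<in> V" "\<phi> \<circ> ?g = \<phi> \<circ> f" using inv_into_into[OF X] f_inv_into_f[OF X] by auto
    then have "\<phi> \<circ> A ?g = \<phi> \<circ> A f"
      using Aut_free_integral_kernel[OF D(1) K(1) \<phi>(1) HA[OF that(1)] ent[OF that(1)], of ?g f] that(2)
      by (simp add: V_def)
    then show ?thesis using X by (simp add: scalar_extend_def Let_def V_def[symmetric])
  qed
  have finX: "finite ?X"
  proof -
    have "?X \<subseteq> {u. \<forall>x. (x \<in> Z \<longrightarrow> u x \<in> carrier K) \<and> (x \<notin> Z \<longrightarrow> u x = \<phi> \<zero>\<^bsub>R\<^esub>)}"
      using ring_hom_memE(1)[OF \<phi>(1)] by (auto simp: V_def free_module_mem_iff)
    then show ?thesis
      using finite_set_of_finite_funs[OF assms(2) K(2), of "\<phi> \<zero>\<^bsub>R\<^esub>"] by (rule finite_subset)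
  qed
  have T_in: "?T A \<in> Bij ?X" if "A \<in> H" for A
  proof -
    let ?B = "inv\<^bsub>Aut_free R Z\<^esub> A"
    have AB: "A \<in> H2" "?B \<in> H2" using HH2 that by auto
    have "bij_betw (?T A) ?X ?X"
    proof (rule bij_betwI[of _ _ _ "?T ?B"])
      show "?T A \<in> ?X \<rightarrow> ?X" "?T ?B \<in> ?X \<rightarrow> ?X" using T pres AB by auto
      fix u assume "u \<in> ?X"
      then obtain f where f: "f \<in> V" "u = \<phi> \<circ> f" by blast
      have fM: "f \<in> carrier (free_module R Z)" using f(1) by (simp add: V_def)
      show "?T ?B (?T A u) = u" "?T A (?T ?B u) = u"
        using f T[OF AB(1)] T[OF AB(2)] pres[OF AB(1)] pres[OF AB(2)] Aut_free_inv[OF HA[OF AB(1)] fM]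
        by simp_all
    qed
    then show ?thesis by (simp add: Bij_def scalar_extend_def Let_def V_def)
  qed
  have "group (BijGroup ?X)" by (rule group_BijGroup)
  moreover have "finite (carrier (BijGroup ?X))"
  proof -
    have "Bij ?X \<subseteq> ?X \<rightarrow>\<^sub>E ?X" by (auto simp: Bij_def PiE_def bij_betw_def)
    then show ?thesis using finX by (auto simp: BijGroup_def intro: finite_subset finite_PiE)
  qed
  moreover have "?T \<in> H \<rightarrow> carrier (BijGroup ?X)" using T_in by (simp add: BijGroup_def)
  moreover have "inj_on ?T H"
  proof (rule inj_onI)
    fix A B assume AB: "A \<in> H" "B \<in> H" "?T A = ?T B"
    show "A = B"
    proof (rule mod_auto_group_eqI)
      show AA: "A \<in> carrier (Aut_free R Z)" "B \<in> carrier (Aut_free R Z)" using AB H by auto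
      fix f assume f: "f \<in> carrier (free_module R Z)"
      have "A (basis_vec R z) = B (basis_vec R z)" if z: "z \<in> Z" for z
      proof
        fix w
        \<comment> \<open>Basis vectors have coordinates 0 and 1, which lie in \<open>D\<close>, so
          equal reductions mean matrix entries that agree under \<open>\<phi>\<close>. Inside
          \<open>Z\<close> these belong to \<open>E\<close>, where \<open>\<phi>\<close> is
          injective; outside \<open>Z\<close> they vanish.\<close>
        have "basis_vec R z \<in> V"
          using basis_vec_closed[OF z] subringE(2,3)[OF D(1)] by (simp add: V_def basis_vec_def)
        then have "\<phi> \<circ> A (basis_vec R z) = \<phi> \<circ> B (basis_vec R z)"
          using T[OF HH2(1)[OF AB(1)]] T[OF HH2(1)[OF AB(2)]] AB(3) by metis
        then have eq: "\<phi> (A (basis_vec R z) w) = \<phi> (B (basis_vec R z) w)" by (metis comp_apply)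
        show "A (basis_vec R z) w = B (basis_vec R z) w"
        proof (cases "w \<in> Z")
          case True
          have "A (basis_vec R z) w \<in> E" "B (basis_vec R z) w \<in> E"
            using E[OF HH2(1) z True] AB by blast+
          then show ?thesis using eq \<phi>(2) by (simp add: inj_on_eq_iff)
        next
          case False
          then show ?thesis using ZR[of A z] ZR[of B z] HH2(1) AB z by (simp add: free_module_mem_iff)
        qed
      qed
      then show "A f = B f" by (rule Aut_free_eq_onI[OF AA subset_refl _ f])
    qed
  qed
  moreover have "?T (A \<otimes>\<^bsub>Aut_free R Z\<^esub> B) = ?T A \<otimes>\<^bsub>BijGroup ?X\<^esub> ?T B"
    if AB: "A \<in> H" "B \<in> H" "A \<otimes>\<^bsub>Aut_free R Z\<^esub> B \<in> H" for A B
  proof (rule extensionalityI[of _ ?X])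
    show "?T (A \<otimes>\<^bsub>Aut_free R Z\<^esub> B) \<in> extensional ?X" by (simp add: scalar_extend_def Let_def V_def)
    show "?T A \<otimes>\<^bsub>BijGroup ?X\<^esub> ?T B \<in> extensional ?X"
      using T_in AB by (simp add: BijGroup_def)
    fix u assume u: "u \<in> ?X"
    then obtain f where f: "f \<in> V" "u = \<phi> \<circ> f" by blast
    have fM: "f \<in> carrier (free_module R Z)" using f(1) by (simp add: V_def)
    have "?T (A \<otimes>\<^bsub>Aut_free R Z\<^esub> B) u = \<phi> \<circ> A (B f)"
      using T[OF HH2(1)[OF AB(3)] f(1)] f(2) mod_auto_group_mult[OF HA[OF HH2(1)[OF AB(1)]] HA[OF HH2(1)[OF AB(2)]] fM]
      by simp
    also have "\<dots> = ?T A (?T B u)" 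
      using T[OF HH2(1)[OF AB(2)] f(1)] T[OF HH2(1)[OF AB(1)] pres[OF HH2(1)[OF AB(2)] f(1)]] f(2) by simp
    also have "\<dots> = (?T A \<otimes>\<^bsub>BijGroup ?X\<^esub> ?T B) u"
      using T_in AB u by (simp add: BijGroup_def compose_def)
    finally show "?T (A \<otimes>\<^bsub>Aut_free R Z\<^esub> B) u = (?T A \<otimes>\<^bsub>BijGroup ?X\<^esub> ?T B) u" .
  qed
  ultimately show "\<exists>(Q :: (('x \<Rightarrow> nat) \<Rightarrow> ('x \<Rightarrow> nat)) monoid) \<psi>. group Q \<and> finite (carrier Q) \<and>
      \<psi> \<in> H \<rightarrow> carrier Q \<and> inj_on \<psi> H \<and>
      (\<forall>g\<in>H. \<forall>h\<in>H. g \<otimes>\<^bsub>Aut_free R Z\<^esub> h \<in> H \<longrightarrow> \<psi> (g \<otimes>\<^bsub>Aut_free R Z\<^esub> h) = \<psi> g \<otimes>\<^bsub>Q\<^esub> \<psi> h)"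
    by (intro exI[of _ "BijGroup ?X"] exI[of _ ?T]) blast
qed

section \<open>The group structure of the linear enrichment\<close>

lemma group_semidirect_product:
  assumes "group N" "group H"
    and hom: "\<And>h. h \<in> carrier H \<Longrightarrow> \<theta> h \<in> hom N N"
    and one: "\<And>n. n \<in> carrier N \<Longrightarrow> \<theta> \<one>\<^bsub>H\<^esub> n = n"
    and mult: "\<And>h k n. h \<in> carrier H \<Longrightarrow> k \<in> carrier H \<Longrightarrow> n \<in> carrier N \<Longrightarrow>
      \<theta> (h \<otimes>\<^bsub>H\<^esub> k) n = \<theta> h (\<theta> k n)"
  shows "group (semidirect_product N H \<theta>)"
proof -
  interpret N: group N by fact
  interpret H: group H by fact
  have cl: "\<theta> h n \<in> carrier N" if "h \<in> carrier H" "n \<in> carrier N" for h n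
    using hom[OF that(1)] that(2) by (auto simp: hom_def)
  have hm: "\<theta> h (n \<otimes>\<^bsub>N\<^esub> m) = \<theta> h n \<otimes>\<^bsub>N\<^esub> \<theta> h m"
    if "h \<in> carrier H" "n \<in> carrier N" "m \<in> carrier N" for h n m
    using hom[OF that(1)] that by (auto simp: hom_def)
  have h1: "\<theta> h \<one>\<^bsub>N\<^esub> = \<one>\<^bsub>N\<^esub>" if "h \<in> carrier H" for h
  proof -
    interpret group_hom N N "\<theta> h" using hom[OF that] by unfold_locales
    show ?thesis by (rule hom_one)
  qed
  show ?thesis
  proof (rule groupI)
    fix x assume "x \<in> carrier (semidirect_product N H \<theta>)"
    then obtain n h where x: "x = (n, h)" "n \<in> carrier N" "h \<in> carrier H"
      by (auto simp: semidirect_product_def)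
    let ?y = "(\<theta> (inv\<^bsub>H\<^esub> h) (inv\<^bsub>N\<^esub> n), inv\<^bsub>H\<^esub> h)"
    have "\<theta> (inv\<^bsub>H\<^esub> h) (inv\<^bsub>N\<^esub> n) \<otimes>\<^bsub>N\<^esub> \<theta> (inv\<^bsub>H\<^esub> h) n = \<one>\<^bsub>N\<^esub>"
      using x hm[of "inv\<^bsub>H\<^esub> h" "inv\<^bsub>N\<^esub> n" n, symmetric] h1 by simp
    then show "\<exists>y\<in>carrier (semidirect_product N H \<theta>).
        y \<otimes>\<^bsub>semidirect_product N H \<theta>\<^esub> x = \<one>\<^bsub>semidirect_product N H \<theta>\<^esub>"
      using x cl by (intro bexI[of _ ?y]) (simp_all add: semidirect_product_def)
  qed (auto simp: semidirect_product_def cl hm one mult N.m_assoc H.m_assoc)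
qed

lemma (in group) conj_mult:
  assumes "l \<in> carrier G" "a \<in> carrier G" "b \<in> carrier G"
  shows "l \<otimes> (a \<otimes> b) \<otimes> inv l = l \<otimes> a \<otimes> inv l \<otimes> (l \<otimes> b \<otimes> inv l)"
proof -
  have "inv l \<otimes> (l \<otimes> x) = x" if "x \<in> carrier G" for x
    using assms(1) that by (simp add: m_assoc[symmetric])
  then show ?thesis using assms by (simp add: m_assoc)
qed

section \<open>The permutation representation and conjugation by it\<close>

lemma linear_action_apply:
  "f \<in> carrier (free_module R S) \<Longrightarrow>
    linear_action G S R \<alpha> g f x = (if x \<in> S then f (\<alpha> (inv\<^bsub>G\<^esub> g) x) else \<zero>\<^bsub>R\<^esub>)"
  by (simp add: linear_action_def)

context group_action
begin

lemma is_group: "group G"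
  using group_hom by (simp add: group_hom_def)

lemma action_closed: "g \<in> carrier G \<Longrightarrow> x \<in> E \<Longrightarrow> \<phi> g x \<in> E"
  using element_image by blast

lemma action_inv [simp]:
  assumes "g \<in> carrier G" "x \<in> E"
  shows "\<phi> (inv g) (\<phi> g x) = x" "\<phi> g (\<phi> (inv g) x) = x"
proof -
  interpret group G by (rule is_group)
  show "\<phi> (inv g) (\<phi> g x) = x" using orbit_sym_aux[OF assms refl] .
  show "\<phi> g (\<phi> (inv g) x) = x" using orbit_sym_aux[of "inv g" x, OF _ _ refl] assms by simp
qed

lemma linear_action_closed:
  assumes "cring R" "g \<in> carrier G" "Z \<subseteq> E" "f \<in> carrier (free_module R Z)"
  shows "linear_action G E R \<phi> g f \<in> carrier (free_module R (\<phi> g ` Z))"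
proof -
  interpret group G by (rule is_group)
  have f: "f \<in> carrier (free_module R E)" using free_module_mono[OF assms(3,4)] .
  have fZ: "f x \<in> carrier R" "x \<notin> Z \<Longrightarrow> f x = \<zero>\<^bsub>R\<^esub>" "finite {x. f x \<noteq> \<zero>\<^bsub>R\<^esub>}" for x
    using assms(4) by (auto simp: free_module_mem_iff)
  have zero: "\<zero>\<^bsub>R\<^esub> \<in> carrier R" using assms(1) by (simp add: cring.axioms ring.ring_simprules)
  have out: "linear_action G E R \<phi> g f x = \<zero>\<^bsub>R\<^esub>" if "x \<notin> \<phi> g ` {x. f x \<noteq> \<zero>\<^bsub>R\<^esub>}" for x
  proof (cases "x \<in> E")
    case True
    then have "x = \<phi> g (\<phi> (inv g) x)" using assms(2) by simp
    then have "f (\<phi> (inv g) x) = \<zero>\<^bsub>R\<^esub>" using that by blast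
    then show ?thesis using True by (simp add: linear_action_apply[OF f])
  qed (simp add: linear_action_apply[OF f])
  have "{x. linear_action G E R \<phi> g f x \<noteq> \<zero>\<^bsub>R\<^esub>} \<subseteq> \<phi> g ` {x. f x \<noteq> \<zero>\<^bsub>R\<^esub>}" using out by blast
  then have "finite {x. linear_action G E R \<phi> g f x \<noteq> \<zero>\<^bsub>R\<^esub>}"
    using fZ(3) by (meson finite_imageI finite_subset)
  moreover have "linear_action G E R \<phi> g f x = \<zero>\<^bsub>R\<^esub>" if "x \<notin> \<phi> g ` Z" for x
    using out[of x] that fZ(2) by blast
  ultimately show ?thesis using fZ(1) zero by (simp add: free_module_mem_iff linear_action_apply[OF f])
qed

lemma linear_action_closed':
  assumes "cring R" "g \<in> carrier G" "f \<in> carrier (free_module R E)"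
  shows "linear_action G E R \<phi> g f \<in> carrier (free_module R E)"
  using linear_action_closed[OF assms(1,2) subset_refl assms(3)] surj_prop[OF assms(2)] by simp

lemma linear_action_mult:
  assumes "cring R" "g \<in> carrier G" "h \<in> carrier G" "f \<in> carrier (free_module R E)"
  shows "linear_action G E R \<phi> (g \<otimes> h) f = linear_action G E R \<phi> g (linear_action G E R \<phi> h f)"
proof
  fix x
  interpret group G by (rule is_group)
  show "linear_action G E R \<phi> (g \<otimes> h) f x = linear_action G E R \<phi> g (linear_action G E R \<phi> h f) x"
    using assms(2,3) action_closed[of "inv g" x]
    by (simp add: linear_action_apply[OF assms(4)] linear_action_apply[OF linear_action_closed'[OF assms(1,3,4)]]
        inv_mult_group composition_rule)
qed

lemma linear_action_one:
  assumes "f \<in> carrier (free_module R E)"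
  shows "linear_action G E R \<phi> \<one> f = f"
proof
  fix x
  interpret group G by (rule is_group)
  have "\<phi> \<one> x = x" if "x \<in> E" using that id_eq_one by (metis restrict_apply')
  then show "linear_action G E R \<phi> \<one> f x = f x"
    using assms by (auto simp: linear_action_apply[OF assms] free_module_mem_iff)
qed

lemma linear_action_Aut:
  assumes "cring R" "g \<in> carrier G"
  shows "linear_action G E R \<phi> g \<in> carrier (Aut_free R E)"
proof (rule mod_auto_groupI)
  interpret group G by (rule is_group)
  interpret R: cring R by fact
  let ?L = "linear_action G E R \<phi>"
  let ?M = "carrier (free_module R E)"
  interpret M: module R "free_module R E" by (rule module_free_module[OF assms(1)])
  show "?L g \<in> extensional ?M" by (simp add: linear_action_def)
  have add: "?L g (\<lambda>x. f x \<oplus>\<^bsub>R\<^esub> h x) = (\<lambda>x. ?L g f x \<oplus>\<^bsub>R\<^esub> ?L g h x)" if "f \<in> ?M" "h \<in> ?M" for f h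
  proof -
    have "(\<lambda>x. f x \<oplus>\<^bsub>R\<^esub> h x) \<in> ?M" using M.a_closed[OF that] by simp
    then show ?thesis using that by (simp add: linear_action_apply fun_eq_iff)
  qed
  have smult: "?L g (\<lambda>x. a \<otimes>\<^bsub>R\<^esub> f x) = (\<lambda>x. a \<otimes>\<^bsub>R\<^esub> ?L g f x)" if "a \<in> carrier R" "f \<in> ?M" for f a
  proof -
    have "(\<lambda>x. a \<otimes>\<^bsub>R\<^esub> f x) \<in> ?M" using M.smult_closed[OF that] by simp
    then show ?thesis using that by (simp add: linear_action_apply fun_eq_iff)
  qed
  show "?L g \<in> mod_hom R (free_module R E) (free_module R E)"
    using linear_action_closed'[OF assms] add smult by (simp add: mod_hom_def)
  show "?L (inv g) \<in> ?M \<rightarrow> ?M" using linear_action_closed'[OF assms(1)] assms(2) by simp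
  show "?L g (?L (inv g) f) = f" if "f \<in> ?M" for f
    using linear_action_mult[OF assms(1,2) _ that, of "inv g"] assms(2) linear_action_one[OF that] by simp
  show "?L (inv g) (?L g f) = f" if "f \<in> ?M" for f
    using linear_action_mult[OF assms(1) _ assms(2) that, of "inv g"] assms(2) linear_action_one[OF that] by simp
qed

lemma linear_action_hom:
  assumes "cring R"
  shows "linear_action G E R \<phi> \<in> hom G (Aut_free R E)"
proof (rule homI)
  interpret group G by (rule is_group)
  interpret A: group "Aut_free R E" using cring.Aut_free_group[OF assms] .
  show "linear_action G E R \<phi> g \<in> carrier (Aut_free R E)" if "g \<in> carrier G" for g
    using linear_action_Aut[OF assms that] .
  show "linear_action G E R \<phi> (g \<otimes> h) =
      linear_action G E R \<phi> g \<otimes>\<^bsub>Aut_free R E\<^esub> linear_action G E R \<phi> h"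
    if "g \<in> carrier G" "h \<in> carrier G" for g h
    using that assms
    by (intro mod_auto_group_eqI)
      (auto intro: linear_action_Aut A.m_closed simp: mod_auto_group_mult linear_action_Aut linear_action_mult)
qed

text \<open>Conjugation translates the support: R[gZ] is pulled back to R[Z], where \<open>A\<close>
  acts, and pushed forward again, while a basis vector off gZ is pulled back to one off
  \<open>Z\<close>, which \<open>A\<close> fixes.\<close>

lemma conj_action_supported:
  assumes "cring R" "g \<in> carrier G" "finite Z" "Z \<subseteq> E" "A \<in> supported_Aut R E Z"
  shows "conj_action G E R \<phi> g A \<in> supported_Aut R E (\<phi> g ` Z)"
    and "f \<in> carrier (free_module R E) \<Longrightarrow> conj_action G E R \<phi> g A f =
      linear_action G E R \<phi> g (A (linear_action G E R \<phi> (inv g) f))"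
proof -
  interpret group G by (rule is_group)
  interpret R: cring R by fact
  interpret Aut: group "Aut_free R E" by (rule R.Aut_free_group)
  let ?L = "linear_action G E R \<phi>"
  interpret L: group_hom G "Aut_free R E" ?L
    using linear_action_hom[OF assms(1)] by unfold_locales
  have AA: "A \<in> carrier (Aut_free R E)" using assms(5) by (simp add: supported_Aut_def)
  have LA: "?L g \<in> carrier (Aut_free R E)" "?L (inv g) \<in> carrier (Aut_free R E)"
    using assms(2) by simp_all
  have AG: "A \<in> carrier (GL_f E R)" using assms(3-5) by (auto simp: R.carrier_GL_f)
  have C: "conj_action G E R \<phi> g A = ?L g \<otimes>\<^bsub>Aut_free R E\<^esub> A \<otimes>\<^bsub>Aut_free R E\<^esub> ?L (inv g)"
    using AG L.hom_inv[OF assms(2)] by (simp add: conj_action_def)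
  have CA: "conj_action G E R \<phi> g A \<in> carrier (Aut_free R E)"
    unfolding C using AA LA by simp
  have ap: "conj_action G E R \<phi> g A f = ?L g (A (?L (inv g) f))" if f: "f \<in> carrier (free_module R E)" for f
    unfolding C using AA LA f by (simp add: mod_auto_group_mult mod_auto_group_closed)
  show "f \<in> carrier (free_module R E) \<Longrightarrow> conj_action G E R \<phi> g A f = ?L g (A (?L (inv g) f))"
    by (rule ap)
  have gZ: "\<phi> g ` Z \<subseteq> E" using assms(2,4) action_closed by blast
  have "\<phi> (inv g) ` \<phi> g ` Z = (\<lambda>x. \<phi> (inv g) (\<phi> g x)) ` Z" by (simp add: image_image)
  also have "\<dots> = Z" using assms(2,4) by (force simp: subset_iff image_iff)
  finally have gZ_inv: "\<phi> (inv g) ` \<phi> g ` Z = Z" .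
  have "conj_action G E R \<phi> g A f \<in> carrier (free_module R (\<phi> g ` Z))"
    if f: "f \<in> carrier (free_module R (\<phi> g ` Z))" for f
  proof -
    have "?L (inv g) f \<in> carrier (free_module R Z)"
      using linear_action_closed[OF assms(1) inv_closed[OF assms(2)] gZ f] gZ_inv by simp
    then have "A (?L (inv g) f) \<in> carrier (free_module R Z)"
      using assms(5) unfolding supported_Aut_def by blast
    then have "?L g (A (?L (inv g) f)) \<in> carrier (free_module R (\<phi> g ` Z))"
      by (rule linear_action_closed[OF assms(1,2,4)])
    then show ?thesis using ap[OF free_module_mono[OF gZ f]] by simp
  qed
  moreover have "conj_action G E R \<phi> g A (basis_vec R x) = basis_vec R x" if x: "x \<in> E - \<phi> g ` Z" for x
  proof -
    have gx: "\<phi> (inv g) x \<in> E - Z"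
      using x assms(2) action_closed[of "inv g" x] action_inv(2)[of g x] by (auto simp: image_iff)
    have "?L (inv g) (basis_vec R x) = basis_vec R (\<phi> (inv g) x)"
      using linear_action_basis_vec[OF assms(1) group_action_axioms, of "inv g" x] assms(2) x by simp
    moreover have "A (basis_vec R (\<phi> (inv g) x)) = basis_vec R (\<phi> (inv g) x)"
      using assms(5) gx by (simp add: supported_Aut_def)
    moreover have "?L g (basis_vec R (\<phi> (inv g) x)) = basis_vec R x"
      using linear_action_basis_vec[OF assms(1) group_action_axioms assms(2), of "\<phi> (inv g) x"] gx x assms(2)
      by simp
    ultimately show ?thesis using ap[OF R.basis_vec_closed, of x] x by simp
  qed
  ultimately show "conj_action G E R \<phi> g A \<in> supported_Aut R E (\<phi> g ` Z)"
    using CA by (auto simp: supported_Aut_def)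
qed

text \<open>The permutation operators need not lie in \<open>GL_f\<close>, but they normalize it
  because a translate of a finite support is finite. The action axioms then follow from conjugation
  in the automorphism group.\<close>

lemma group_lin_enrichment:
  assumes "cring R"
  shows "group (lin_enrichment G E R \<phi>)"
  unfolding lin_enrichment_def
proof (rule group_semidirect_product)
  interpret G: group G by (rule is_group)
  interpret R: cring R by fact
  interpret Aut: group "Aut_free R E" by (rule R.Aut_free_group)
  let ?L = "linear_action G E R \<phi>"
  interpret L: group_hom G "Aut_free R E" ?L
    using linear_action_hom[OF assms(1)] by unfold_locales
  show "group G" by (rule is_group)
  have GL: "GL_f E R = (Aut_free R E)\<lparr>carrier := carrier (GL_f E R)\<rparr>" by (simp add: GL_f_def)
  show "group (GL_f E R)"
    using subgroup.subgroup_is_group[OF R.GL_f_subgroup Aut.group_axioms] GL by metis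
  have GLsub: "A \<in> carrier (Aut_free R E)" if "A \<in> carrier (GL_f E R)" for A
    using subgroup.subset[OF R.GL_f_subgroup] that by blast
  have GLmult: "monoid.mult (GL_f E R) = monoid.mult (Aut_free R E)" by (simp add: GL_f_def)
  have C: "conj_action G E R \<phi> g A = ?L g \<otimes>\<^bsub>Aut_free R E\<^esub> A \<otimes>\<^bsub>Aut_free R E\<^esub> inv\<^bsub>Aut_free R E\<^esub> (?L g)"
    if "A \<in> carrier (GL_f E R)" for g A using that by (simp add: conj_action_def)
  have closed: "conj_action G E R \<phi> g A \<in> carrier (GL_f E R)"
    if g: "g \<in> carrier G" and A: "A \<in> carrier (GL_f E R)" for g A
  proof -
    obtain Z where Z: "finite Z" "Z \<subseteq> E" "A \<in> supported_Aut R E Z" using A by (auto simp: R.carrier_GL_f)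
    have "\<phi> g ` Z \<subseteq> E" using Z(2) g action_closed by blast
    then show ?thesis using conj_action_supported(1)[OF assms g Z] Z(1) by (auto simp: R.carrier_GL_f)
  qed
  show "conj_action G E R \<phi> g \<in> hom (GL_f E R) (GL_f E R)" if g: "g \<in> carrier G" for g
  proof (rule homI)
    fix A B assume AB: "A \<in> carrier (GL_f E R)" "B \<in> carrier (GL_f E R)"
    then have "A \<otimes>\<^bsub>GL_f E R\<^esub> B \<in> carrier (GL_f E R)"
      using subgroup.m_closed[OF R.GL_f_subgroup] by (simp add: GLmult)
    then show "conj_action G E R \<phi> g (A \<otimes>\<^bsub>GL_f E R\<^esub> B) =
        conj_action G E R \<phi> g A \<otimes>\<^bsub>GL_f E R\<^esub> conj_action G E R \<phi> g B"
      using Aut.conj_mult[of "?L g" A B] g GLsub[OF AB(1)] GLsub[OF AB(2)] AB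
      by (simp add: C GLmult del: L.hom_inv)
  qed (use closed g in blast)
  show "conj_action G E R \<phi> \<one> A = A" if "A \<in> carrier (GL_f E R)" for A
    using that GLsub[OF that] by (simp add: C L.hom_one del: L.hom_inv)
  show "conj_action G E R \<phi> (g \<otimes> h) A = conj_action G E R \<phi> g (conj_action G E R \<phi> h A)"
    if "g \<in> carrier G" "h \<in> carrier G" "A \<in> carrier (GL_f E R)" for g h A
  proof -
    have "?L g \<in> carrier (Aut_free R E)" "?L h \<in> carrier (Aut_free R E)" using that by simp_all
    then show ?thesis
      using that GLsub[OF that(3)] closed[OF that(2,3)]
      by (simp add: C Aut.m_assoc Aut.inv_mult_group L.hom_mult del: L.hom_inv)
  qed
qed

end

section \<open>Transport along an injection of supports\<close>

text \<open>The projection of R[Y] onto R[\<pi>(Z)], followed by the identification of the latter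
  with R[Z].\<close>

definition pull_back :: "('r, 'm) ring_scheme \<Rightarrow> 'x set \<Rightarrow> ('x \<Rightarrow> 'y) \<Rightarrow> ('y \<Rightarrow> 'r) \<Rightarrow> 'x \<Rightarrow> 'r" where
  "pull_back R Z \<pi> f = (\<lambda>x. if x \<in> Z then f (\<pi> x) else \<zero>\<^bsub>R\<^esub>)"

text \<open>The block matrix that acts as \<open>A\<close> on the coordinates in \<pi>(Z) and as the
  identity on the remaining ones.\<close>

definition transport_Aut ::
  "('r, 'm) ring_scheme \<Rightarrow> 'x set \<Rightarrow> 'y set \<Rightarrow> ('x \<Rightarrow> 'y) \<Rightarrow> (('x \<Rightarrow> 'r) \<Rightarrow> ('x \<Rightarrow> 'r)) \<Rightarrow>
    ('y \<Rightarrow> 'r) \<Rightarrow> ('y \<Rightarrow> 'r)" where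
  "transport_Aut R Z Y \<pi> A = restrict
     (\<lambda>f y. if y \<in> \<pi> ` Z then A (pull_back R Z \<pi> f) (inv_into Z \<pi> y) else f y)
     (carrier (free_module R Y))"

text \<open>Only the injection is fixed here. No equivariance is assumed; it enters later, in
  \<open>transport_conj\<close>, and just for the points that matter there.\<close>

locale support_transport = cring R for R (structure) +
  fixes S Z :: "'x set" and Y :: "'y set" and \<pi> :: "'x \<Rightarrow> 'y"
  assumes finite_Z: "finite Z" and Z_sub: "Z \<subseteq> S" and finite_Y: "finite Y"
    and \<pi>_in: "\<And>x. x \<in> Z \<Longrightarrow> \<pi> x \<in> Y" and \<pi>_inj: "inj_on \<pi> Z"
begin

abbreviation "pull \<equiv> pull_back R Z \<pi>"
abbreviation "T \<equiv> transport_Aut R Z Y \<pi>"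

lemma pull_closed:
  assumes "f \<in> carrier (free_module R Y)"
  shows "pull f \<in> carrier (free_module R Z)"
proof -
  have "{x. pull f x \<noteq> \<zero>} \<subseteq> Z" by (auto simp: pull_back_def)
  then show ?thesis
    using assms finite_subset[OF _ finite_Z] by (auto simp: free_module_mem_iff pull_back_def)
qed

lemma pull_closed': "f \<in> carrier (free_module R Y) \<Longrightarrow> pull f \<in> carrier (free_module R S)"
  using free_module_mono[OF Z_sub pull_closed] .

lemma transport_in:
  assumes "f \<in> carrier (free_module R Y)" "z \<in> Z"
  shows "T A f (\<pi> z) = A (pull f) z"
  using assms \<pi>_inj by (simp add: transport_Aut_def)

lemma transport_out:
  assumes "f \<in> carrier (free_module R Y)" "y \<notin> \<pi> ` Z"
  shows "T A f y = f y"
  using assms by (simp add: transport_Aut_def)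

lemma supported_closed:
  assumes "A \<in> supported_Aut R S Z" "f \<in> carrier (free_module R Y)"
  shows "A (pull f) \<in> carrier (free_module R Z)"
  using assms(1) pull_closed[OF assms(2)] unfolding supported_Aut_def by blast

lemma transport_closed:
  assumes "A \<in> supported_Aut R S Z" "f \<in> carrier (free_module R Y)"
  shows "T A f \<in> carrier (free_module R Y)"
proof -
  have R: "T A f y \<in> carrier R" for y
  proof (cases "y \<in> \<pi> ` Z")
    case True
    then obtain z where "z \<in> Z" "y = \<pi> z" by blast
    then show ?thesis
      using transport_in[OF assms(2)] supported_closed[OF assms] by (simp add: free_module_mem_iff)
  next
    case False
    then show ?thesis using assms(2) by (simp add: transport_out free_module_mem_iff)
  qed
  have out: "T A f y = \<zero>" if "y \<notin> Y" for y
  proof -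
    have "y \<notin> \<pi> ` Z" using that \<pi>_in by blast
    then show ?thesis using assms(2) that by (simp add: transport_out free_module_mem_iff)
  qed
  then have "{y. T A f y \<noteq> \<zero>} \<subseteq> Y" by blast
  then have "finite {y. T A f y \<noteq> \<zero>}" using finite_Y by (rule finite_subset)
  with R out show ?thesis by (simp add: free_module_mem_iff)
qed

text \<open>The projection to R[Z] intertwines \<open>T A\<close> with \<open>A\<close>.
  Multiplicativity and injectivity of \<open>T\<close> both rest on this.\<close>

lemma pull_transport:
  assumes "A \<in> supported_Aut R S Z" "f \<in> carrier (free_module R Y)"
  shows "pull (T A f) = A (pull f)"
proof
  fix x
  show "pull (T A f) x = A (pull f) x"
    using supported_closed[OF assms] transport_in[OF assms(2), of x A]
    by (simp add: pull_back_def free_module_mem_iff)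
qed

lemma transport_mult_apply:
  assumes AB: "A \<in> supported_Aut R S Z" "B \<in> supported_Aut R S Z" and f: "f \<in> carrier (free_module R Y)"
  shows "T (A \<otimes>\<^bsub>Aut_free R S\<^esub> B) f = T A (T B f)"
proof
  fix y
  have c: "A \<in> carrier (Aut_free R S)" "B \<in> carrier (Aut_free R S)" using AB by (auto simp: supported_Aut_def)
  have TB: "T B f \<in> carrier (free_module R Y)" by (rule transport_closed[OF AB(2) f])
  show "T (A \<otimes>\<^bsub>Aut_free R S\<^esub> B) f y = T A (T B f) y"
  proof (cases "y \<in> \<pi> ` Z")
    case True
    then obtain z where z: "z \<in> Z" "y = \<pi> z" by blast
    show ?thesis
      using transport_in[OF f z(1)] transport_in[OF TB z(1)] pull_transport[OF AB(2) f]
        mod_auto_group_mult[OF c pull_closed'[OF f]] z(2) by simp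
  next
    case False
    then show ?thesis using transport_out[OF f False] transport_out[OF TB False] by simp
  qed
qed

lemma transport_one_apply:
  assumes f: "f \<in> carrier (free_module R Y)"
  shows "T \<one>\<^bsub>Aut_free R S\<^esub> f = f"
proof
  fix y
  show "T \<one>\<^bsub>Aut_free R S\<^esub> f y = f y"
  proof (cases "y \<in> \<pi> ` Z")
    case True
    then obtain z where z: "z \<in> Z" "y = \<pi> z" by blast
    have "\<one>\<^bsub>Aut_free R S\<^esub> (pull f) = pull f" by (rule mod_auto_group_one[OF pull_closed'[OF f]])
    moreover have "pull f z = f (\<pi> z)" using z(1) by (simp add: pull_back_def)
    ultimately show ?thesis using transport_in[OF f z(1), of "\<one>\<^bsub>Aut_free R S\<^esub>"] z(2) by simp
  qed (rule transport_out[OF f])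
qed

lemma transport_Aut_closed:
  assumes A: "A \<in> supported_Aut R S Z"
  shows "T A \<in> carrier (Aut_free R Y)"
proof (rule mod_auto_groupI)
  let ?M = "carrier (free_module R Y)"
  let ?B = "inv\<^bsub>Aut_free R S\<^esub> A"
  interpret G: group "Aut_free R S" by (rule Aut_free_group)
  interpret M: module R "free_module R Y" by (rule module_free_module[OF is_cring])
  have AA: "A \<in> carrier (Aut_free R S)" using A by (simp add: supported_Aut_def)
  have B: "?B \<in> supported_Aut R S Z" using subgroup.m_inv_closed[OF supported_Aut_subgroup[OF Z_sub] A] .
  show "T A \<in> extensional ?M" by (simp add: transport_Aut_def)
  have add: "T A (\<lambda>x. f x \<oplus> g x) = (\<lambda>x. T A f x \<oplus> T A g x)" if f: "f \<in> ?M" and g: "g \<in> ?M" for f g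
  proof
    fix y
    have fg: "(\<lambda>x. f x \<oplus> g x) \<in> ?M" using M.a_closed[OF f g] by simp
    have "pull (\<lambda>x. f x \<oplus> g x) = (\<lambda>x. pull f x \<oplus> pull g x)" by (auto simp: pull_back_def)
    then have "A (pull (\<lambda>x. f x \<oplus> g x)) = (\<lambda>x. A (pull f) x \<oplus> A (pull g) x)"
      using Aut_free_add[OF AA pull_closed'[OF f] pull_closed'[OF g]] by simp
    then show "T A (\<lambda>x. f x \<oplus> g x) y = T A f y \<oplus> T A g y"
      using fg f g by (simp add: transport_Aut_def)
  qed
  have smult: "T A (\<lambda>x. a \<otimes> f x) = (\<lambda>x. a \<otimes> T A f x)" if a: "a \<in> carrier R" and f: "f \<in> ?M" for a f
  proof
    fix y
    have af: "(\<lambda>x. a \<otimes> f x) \<in> ?M" using M.smult_closed[OF a f] by simp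
    have "pull (\<lambda>x. a \<otimes> f x) = (\<lambda>x. a \<otimes> pull f x)" using a by (auto simp: pull_back_def)
    then have "A (pull (\<lambda>x. a \<otimes> f x)) = (\<lambda>x. a \<otimes> A (pull f) x)"
      using Aut_free_smult[OF AA pull_closed'[OF f] a] by simp
    then show "T A (\<lambda>x. a \<otimes> f x) y = a \<otimes> T A f y"
      using af f by (simp add: transport_Aut_def)
  qed
  show "T A \<in> mod_hom R (free_module R Y) (free_module R Y)"
    using transport_closed[OF A] add smult by (simp add: mod_hom_def)
  show "T ?B \<in> ?M \<rightarrow> ?M" using transport_closed[OF B] by simp
  show "T A (T ?B f) = f" if "f \<in> ?M" for f
    using transport_mult_apply[OF A B that] transport_one_apply[OF that] AA by simp
  show "T ?B (T A f) = f" if "f \<in> ?M" for f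
    using transport_mult_apply[OF B A that] transport_one_apply[OF that] AA by simp
qed

lemma transport_mult:
  assumes AB: "A \<in> supported_Aut R S Z" "B \<in> supported_Aut R S Z"
  shows "T (A \<otimes>\<^bsub>Aut_free R S\<^esub> B) = T A \<otimes>\<^bsub>Aut_free R Y\<^esub> T B"
proof (rule mod_auto_group_eqI)
  interpret G: group "Aut_free R Y" by (rule Aut_free_group)
  have T: "T A \<in> carrier (Aut_free R Y)" "T B \<in> carrier (Aut_free R Y)"
    using AB transport_Aut_closed by blast+
  have "A \<otimes>\<^bsub>Aut_free R S\<^esub> B \<in> supported_Aut R S Z"
    using subgroup.m_closed[OF supported_Aut_subgroup[OF Z_sub] AB] .
  then show "T (A \<otimes>\<^bsub>Aut_free R S\<^esub> B) \<in> carrier (Aut_free R Y)" by (rule transport_Aut_closed)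
  show "T A \<otimes>\<^bsub>Aut_free R Y\<^esub> T B \<in> carrier (Aut_free R Y)" using T by simp
  show "T (A \<otimes>\<^bsub>Aut_free R S\<^esub> B) f = (T A \<otimes>\<^bsub>Aut_free R Y\<^esub> T B) f" if "f \<in> carrier (free_module R Y)" for f
    using transport_mult_apply[OF AB that] mod_auto_group_mult[OF T that] by simp
qed

lemma transport_inj: "inj_on T (supported_Aut R S Z)"
proof (rule inj_onI)
  fix A B assume AB: "A \<in> supported_Aut R S Z" "B \<in> supported_Aut R S Z" and eq: "T A = T B"
  show "A = B"
  proof (rule supported_Aut_eqI[OF AB Z_sub])
    fix f assume f: "f \<in> carrier (free_module R Z)"
    \<comment> \<open>The push-forward of \<open>f\<close> along \<open>\<pi>\<close>, a preimage of
      \<open>f\<close> under \<open>pull\<close>. Hence \<open>T A\<close> determines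
      \<open>A\<close> on all of R[Z].\<close>
    define u where "u = (\<lambda>y. if y \<in> \<pi> ` Z then f (inv_into Z \<pi> y) else \<zero>)"
    have supp: "{y. u y \<noteq> \<zero>} \<subseteq> Y" using \<pi>_in by (auto simp: u_def)
    have uR: "u y \<in> carrier R" for y using f by (simp add: u_def free_module_mem_iff)
    have u: "u \<in> carrier (free_module R Y)"
      using supp uR finite_subset[OF supp finite_Y] by (auto simp: free_module_mem_iff)
    have "pull u = f"
    proof
      fix x show "pull u x = f x"
        using f \<pi>_inj by (simp add: pull_back_def u_def free_module_mem_iff)
    qed
    then show "A f = B f" using pull_transport[OF AB(1) u] pull_transport[OF AB(2) u] eq by simp
  qed
qed

text \<open>Coordinates in \<open>Z\<close> but outside the true support are left alone by
  \<open>A\<close>, exactly as by the default branch of the transport. So an operator and its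
  conjugate, whose supports differ, can be handled by one and the same \<open>T\<close>, each
  computed on its own support.\<close>

lemma transport_restrict:
  assumes "Z' \<subseteq> Z" and A: "A \<in> supported_Aut R S Z'"
  shows "T A = transport_Aut R Z' Y \<pi> A"
proof (rule extensionalityI[of _ "carrier (free_module R Y)"])
  interpret Z': support_transport R S Z' Y \<pi>
    using assms(1) finite_Z Z_sub finite_Y \<pi>_in \<pi>_inj
    by unfold_locales (auto intro: finite_subset inj_on_subset)
  show "T A \<in> extensional (carrier (free_module R Y))" by (simp add: transport_Aut_def)
  show "transport_Aut R Z' Y \<pi> A \<in> extensional (carrier (free_module R Y))"
    by (simp add: transport_Aut_def)
  fix f assume f: "f \<in> carrier (free_module R Y)"
  show "T A f = transport_Aut R Z' Y \<pi> A f"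
  proof
    fix y
    consider z where "z \<in> Z'" "y = \<pi> z" | z where "z \<in> Z - Z'" "y = \<pi> z" | "y \<notin> \<pi> ` Z" by blast
    then show "T A f y = transport_Aut R Z' Y \<pi> A f y"
    proof cases
      case 1
      have "supp_restrict R Z' (pull f) = pull_back R Z' \<pi> f"
        using assms(1) by (auto simp: supp_restrict_def pull_back_def fun_eq_iff)
      then show ?thesis
        using 1 assms(1) transport_in[OF f, of z A] Z'.transport_in[OF f, of z A]
          supported_Aut_apply[OF A Z'.Z_sub pull_closed'[OF f], of z] by auto
    next
      case 2
      then have "y \<notin> \<pi> ` Z'" using \<pi>_inj assms(1) by (auto simp: inj_on_def)
      then show ?thesis
        using 2 transport_in[OF f, of z A] Z'.transport_out[OF f, of y A]
          supported_Aut_apply[OF A Z'.Z_sub pull_closed'[OF f], of z] by (simp add: pull_back_def)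
    next
      case 3
      then have "y \<notin> \<pi> ` Z'" using assms(1) by blast
      then show ?thesis using transport_out[OF f 3] Z'.transport_out[OF f] by simp
    qed
  qed
qed

text \<open>Equivariance of \<open>\<pi>\<close> on the support \<open>Z'\<close> of
  \<open>A\<close> is enough: it carries \<pi>(Z') to \<pi>(gZ') under \<open>\<beta> q\<close>,
  matching the two blocks, and both sides merely permute the other coordinates. The relation is
  stated as a commutation, the form in which it is inserted into products.\<close>

lemma transport_conj:
  assumes act: "group_action G S \<alpha>" "g \<in> carrier G"
    and act': "group_action Q Y \<beta>" "q \<in> carrier Q"
    and Z': "Z' \<subseteq> Z" "\<alpha> g ` Z' \<subseteq> Z"
    and eqv: "\<And>x. x \<in> Z' \<Longrightarrow> \<pi> (\<alpha> g x) = \<beta> q (\<pi> x)"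
    and A: "A \<in> supported_Aut R S Z'"
  shows "T (conj_action G S R \<alpha> g A) \<otimes>\<^bsub>Aut_free R Y\<^esub> linear_action Q Y R \<beta> q =
    linear_action Q Y R \<beta> q \<otimes>\<^bsub>Aut_free R Y\<^esub> T A"
proof -
  interpret \<alpha>: group_action G S \<alpha> by fact
  interpret \<beta>: group_action Q Y \<beta> by fact
  interpret G: group G by (rule \<alpha>.is_group)
  interpret Q: group Q by (rule \<beta>.is_group)
  interpret AutY: group "Aut_free R Y" by (rule Aut_free_group)
  interpret Z': support_transport R S Z' Y \<pi>
    using Z'(1) finite_Z Z_sub finite_Y \<pi>_in \<pi>_inj
    by unfold_locales (auto intro: finite_subset inj_on_subset)
  interpret gZ': support_transport R S "\<alpha> g ` Z'" Y \<pi>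
    using Z'(2) finite_Z Z_sub finite_Y \<pi>_in \<pi>_inj
    by unfold_locales (auto intro: finite_subset inj_on_subset)
  let ?C = "conj_action G S R \<alpha> g A"
  let ?P = "linear_action Q Y R \<beta> q"
  have C: "?C \<in> supported_Aut R S (\<alpha> g ` Z')"
    using \<alpha>.conj_action_supported(1)[OF is_cring act(2) Z'.finite_Z Z'.Z_sub A] .
  have TC: "T ?C = transport_Aut R (\<alpha> g ` Z') Y \<pi> ?C" by (rule transport_restrict[OF Z'(2) C])
  have TA: "T A = transport_Aut R Z' Y \<pi> A" by (rule transport_restrict[OF Z'(1) A])
  have cl: "T ?C \<in> carrier (Aut_free R Y)" "T A \<in> carrier (Aut_free R Y)" "?P \<in> carrier (Aut_free R Y)"
    unfolding TC TA using gZ'.transport_Aut_closed[OF C] Z'.transport_Aut_closed[OF A]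
      \<beta>.linear_action_Aut[OF is_cring act'(2)] by simp_all
  show ?thesis
  proof (rule mod_auto_group_eqI)
    show "T ?C \<otimes>\<^bsub>Aut_free R Y\<^esub> ?P \<in> carrier (Aut_free R Y)" "?P \<otimes>\<^bsub>Aut_free R Y\<^esub> T A \<in> carrier (Aut_free R Y)"
      using cl by simp_all
    fix f assume f: "f \<in> carrier (free_module R Y)"
    have Pf: "?P f \<in> carrier (free_module R Y)" using mod_auto_group_closed[OF cl(3) f] .
    have TAf: "T A f \<in> carrier (free_module R Y)" using mod_auto_group_closed[OF cl(2) f] .
    have "T ?C (?P f) y = ?P (T A f) y" for y
    proof -
      consider z where "z \<in> Z'" "y = \<pi> (\<alpha> g z)" | "y \<in> Y" "y \<notin> \<pi> ` \<alpha> g ` Z'" | "y \<notin> Y" by blast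
      then show ?thesis
      proof cases
        case 1
        have zS: "z \<in> S" and zY: "\<pi> z \<in> Y" and yq: "y = \<beta> q (\<pi> z)"
          using 1 Z'.Z_sub Z'.\<pi>_in eqv by auto
        have yY: "y \<in> Y" using yq zY \<beta>.action_closed[OF act'(2)] by blast
        have gzS: "\<alpha> g z \<in> S" using \<alpha>.action_closed[OF act(2) zS] .
        have pS: "gZ'.pull (?P f) \<in> carrier (free_module R S)" by (rule gZ'.pull_closed'[OF Pf])
        \<comment> \<open>Permuting by \<open>q\<close>, reading coordinates on gZ' and translating
          back by the inverse of \<open>g\<close> amounts to reading coordinates on Z'. Off Z' both
          sides vanish because \<open>\<alpha> g\<close> is injective.\<close>
        have p: "linear_action G S R \<alpha> (inv\<^bsub>G\<^esub> g) (gZ'.pull (?P f)) = Z'.pull f"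
        proof
          fix x
          have "linear_action G S R \<alpha> (inv\<^bsub>G\<^esub> g) (gZ'.pull (?P f)) x =
              (if x \<in> S then gZ'.pull (?P f) (\<alpha> g x) else \<zero>)"
            using act(2) by (simp add: linear_action_apply[OF pS])
          also have "\<dots> = Z'.pull f x"
          proof (cases "x \<in> Z'")
            case True
            then have "x \<in> S" "\<pi> x \<in> Y" using Z'.Z_sub Z'.\<pi>_in by auto
            moreover have "\<beta> q (\<pi> x) \<in> Y" using \<beta>.action_closed[OF act'(2)] calculation(2) .
            ultimately show ?thesis
              using True eqv[OF True] act'(2) by (simp add: linear_action_apply[OF f] pull_back_def)
          next
            case False
            have "\<alpha> g x \<notin> \<alpha> g ` Z'" if "x \<in> S"
              using False that Z'.Z_sub \<alpha>.inj_prop[OF act(2)] by (auto simp: inj_on_def)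
            then show ?thesis using False by (simp add: pull_back_def)
          qed
          finally show "linear_action G S R \<alpha> (inv\<^bsub>G\<^esub> g) (gZ'.pull (?P f)) x = Z'.pull f x" .
        qed
        have "T ?C (?P f) y = ?C (gZ'.pull (?P f)) (\<alpha> g z)"
          unfolding TC 1(2) using gZ'.transport_in[OF Pf, of "\<alpha> g z"] 1(1) by simp
        also have "\<dots> = linear_action G S R \<alpha> g (A (Z'.pull f)) (\<alpha> g z)"
          using \<alpha>.conj_action_supported(2)[OF is_cring act(2) Z'.finite_Z Z'.Z_sub A pS] p by simp
        also have "\<dots> = A (Z'.pull f) z"
        proof -
          have "A (Z'.pull f) \<in> carrier (free_module R S)"
            using free_module_mono[OF Z'.Z_sub Z'.supported_closed[OF A f]] .
          then show ?thesis using gzS act(2) zS by (simp add: linear_action_apply)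
        qed
        also have "\<dots> = T A f (\<pi> z)" unfolding TA using Z'.transport_in[OF f 1(1)] by simp
        also have "\<dots> = ?P (T A f) y"
          using yY yq zY act'(2) by (simp add: linear_action_apply[OF TAf])
        finally show ?thesis .
      next
        case 2
        \<comment> \<open>By equivariance, a point outside the block of the conjugate comes from a
          point outside the block of \<open>A\<close>, so both sides return the same untouched
          coordinate of \<open>f\<close>.\<close>
        have qy: "\<beta> (inv\<^bsub>Q\<^esub> q) y \<notin> \<pi> ` Z'"
        proof
          assume "\<beta> (inv\<^bsub>Q\<^esub> q) y \<in> \<pi> ` Z'"
          then obtain z where z: "z \<in> Z'" "\<beta> (inv\<^bsub>Q\<^esub> q) y = \<pi> z" by blast
          then have "y = \<pi> (\<alpha> g z)" using eqv[OF z(1)] \<beta>.action_inv(2)[OF act'(2) 2(1)] by simp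
          then show False using 2(2) z(1) by blast
        qed
        have "T ?C (?P f) y = f (\<beta> (inv\<^bsub>Q\<^esub> q) y)"
          unfolding TC using gZ'.transport_out[OF Pf 2(2)] 2(1) by (simp add: linear_action_apply[OF f])
        also have "\<dots> = ?P (T A f) y"
          using 2(1) Z'.transport_out[OF f qy] by (simp add: linear_action_apply[OF TAf[unfolded TA]] TA)
        finally show ?thesis .
      next
        case 3
        have "T ?C (?P f) \<in> carrier (free_module R Y)" "?P (T A f) \<in> carrier (free_module R Y)"
          using mod_auto_group_closed[OF cl(1) Pf] mod_auto_group_closed[OF cl(3) TAf] by simp_all
        then show ?thesis using 3 by (simp add: free_module_mem_iff)
      qed
    qed
    then show "(T ?C \<otimes>\<^bsub>Aut_free R Y\<^esub> ?P) f = (?P \<otimes>\<^bsub>Aut_free R Y\<^esub> T A) f"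
      using mod_auto_group_mult[OF cl(1,3) f] mod_auto_group_mult[OF cl(3,2) f] by auto
  qed
qed

end

section \<open>The linear enrichment is LEF\<close>

text \<open>For a product (A, g)(B, h) the first component is \<open>A\<close> times the conjugate
  of \<open>B\<close>. The transported conjugate stands to the left of the permutation of
  \<open>\<rho> g\<close>, and commuting them turns it into \<open>T B\<close> on the right, which
  gives the product of the two images. The hypothesis on automorphism groups is applied to the set
  \<open>Y\<close>, which comes as a set of naturals.\<close>

lemma LEF_group_lin_enrichment:
  fixes G :: "('g, 'k) monoid_scheme" and S :: "'x set" and R :: "('r, 'm) ring_scheme"
  assumes "LEF_group G" "LEF_action G S \<alpha>" "cring R"
    and Aut: "\<And>Z :: nat set. finite Z \<Longrightarrow> LEF_group (Aut_free R Z)"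
  shows "LEF_group (lin_enrichment G S R \<alpha>)"
proof (rule LEF_groupI[where 'q = "nat \<times> nat"])
  interpret cring R by fact
  interpret \<alpha>: group_action G S \<alpha> using assms(2) by (simp add: LEF_action_def)
  interpret G: group G by (rule \<alpha>.is_group)
  interpret AutS: group "Aut_free R S" by (rule Aut_free_group)
  show "group (lin_enrichment G S R \<alpha>)" by (rule \<alpha>.group_lin_enrichment[OF assms(3)])
  let ?E = "lin_enrichment G S R \<alpha>"
  fix H assume H: "finite H" "H \<subseteq> carrier ?E"
  define F where "F = snd ` H"
  have F: "finite F" "F \<subseteq> carrier G"
    using H by (auto simp: F_def lin_enrichment_def semidirect_product_def)
  have "\<forall>p\<in>H. \<exists>Z. finite Z \<and> Z \<subseteq> S \<and> fst p \<in> supported_Aut R S Z"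
  proof
    fix p assume "p \<in> H"
    then have "fst p \<in> carrier (GL_f S R)"
      using H(2) by (auto simp: lin_enrichment_def semidirect_product_def)
    then show "\<exists>Z. finite Z \<and> Z \<subseteq> S \<and> fst p \<in> supported_Aut R S Z"
      by (auto simp: carrier_GL_f)
  qed
  then obtain Zf where Zf: "\<And>p. p \<in> H \<Longrightarrow> finite (Zf p) \<and> Zf p \<subseteq> S \<and> fst p \<in> supported_Aut R S (Zf p)"
    by metis
  define Z0 where "Z0 = (\<Union>p\<in>H. Zf p)"
  \<comment> \<open>Equivariance of \<open>\<pi>\<close> at x under g is granted only if both x and
    its translate lie in \<open>Z\<close>; this choice secures it for all x in \<open>Z0\<close> and
    g in \<open>F\<close>.\<close>
  define Z where "Z = Z0 \<union> (\<Union>g\<in>F. \<alpha> g ` Z0)"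
  have Z0: "finite Z0" "Z0 \<subseteq> S" using Zf H(1) unfolding Z0_def by blast+
  have supp0: "fst p \<in> supported_Aut R S Z0" if "p \<in> H" for p
    using Zf[OF that] Z0(2) that by (intro supported_Aut_mono[of "fst p" S "Zf p" Z0]) (auto simp: Z0_def)
  have "finite Z" using Z0(1) F(1) by (simp add: Z_def)
  have "Z \<subseteq> S" using Z0(2) F(2) \<alpha>.action_closed unfolding Z_def by blast
  have Z0Z: "Z0 \<subseteq> Z" "\<And>g. g \<in> F \<Longrightarrow> \<alpha> g ` Z0 \<subseteq> Z" by (auto simp: Z_def)
  have supp: "fst p \<in> supported_Aut R S Z" if "p \<in> H" for p
    using supported_Aut_mono[OF supp0[OF that] Z0Z(1) \<open>Z \<subseteq> S\<close>] .
  from assms(2) \<open>finite Z\<close> \<open>Z \<subseteq> S\<close> F obtain Q0 :: "nat monoid" and Y :: "nat set" and \<beta> \<rho> \<pi> where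
    Y: "finite Y" "group_action Q0 Y \<beta>" and \<rho>: "\<rho> \<in> carrier G \<rightarrow> carrier Q0" and \<pi>: "\<pi> \<in> Z \<rightarrow> Y" "inj_on \<pi> Z"
    and \<rho>_mult: "\<And>g h. g \<in> F \<Longrightarrow> h \<in> F \<Longrightarrow> g \<otimes>\<^bsub>G\<^esub> h \<in> F \<Longrightarrow> \<rho> (g \<otimes>\<^bsub>G\<^esub> h) = \<rho> g \<otimes>\<^bsub>Q0\<^esub> \<rho> h"
    and eqv: "\<And>g x. g \<in> F \<Longrightarrow> x \<in> Z \<Longrightarrow> \<alpha> g x \<in> Z \<Longrightarrow> \<pi> (\<alpha> g x) = \<beta> (\<rho> g) (\<pi> x)"
    unfolding LEF_action_def by metis
  interpret \<beta>: group_action Q0 Y \<beta> by (rule Y)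
  interpret tr: support_transport R S Z Y \<pi>
    using \<open>finite Z\<close> \<open>Z \<subseteq> S\<close> Y(1) \<pi> by unfold_locales auto
  interpret AutY: group "Aut_free R Y" by (rule Aut_free_group)
  let ?P = "linear_action Q0 Y R \<beta>"
  have P: "?P \<in> hom Q0 (Aut_free R Y)" by (rule \<beta>.linear_action_hom[OF assms(3)])
  define \<Psi> where "\<Psi> = (\<lambda>(A, g). tr.T A \<otimes>\<^bsub>Aut_free R Y\<^esub> ?P (\<rho> g))"
  have Q0: "\<rho> g \<in> carrier Q0" if "g \<in> F" for g using \<rho> F(2) that by blast
  have PY: "?P (\<rho> g) \<in> carrier (Aut_free R Y)" if "g \<in> F" for g
    by (rule hom_in_carrier[OF P Q0[OF that]])
  have snd: "snd p \<in> F" if "p \<in> H" for p using that by (simp add: F_def)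
  have \<Psi>_in: "\<Psi> p \<in> carrier (Aut_free R Y)" if "p \<in> H" for p
    using tr.transport_Aut_closed[OF supp[OF that]] PY[OF snd[OF that]]
    by (simp add: \<Psi>_def case_prod_unfold)
  have \<Psi>_mult: "\<Psi> (p \<otimes>\<^bsub>?E\<^esub> r) = \<Psi> p \<otimes>\<^bsub>Aut_free R Y\<^esub> \<Psi> r" if "p \<in> H" "r \<in> H" "p \<otimes>\<^bsub>?E\<^esub> r \<in> H" for p r
  proof -
    obtain A g B h where p: "p = (A, g)" and r: "r = (B, h)" by (metis surj_pair)
    have g: "g \<in> F" "g \<in> carrier G" using snd[OF that(1)] F(2) by (auto simp: p)
    have h: "h \<in> F" using snd[OF that(2)] by (simp add: r)
    let ?C = "conj_action G S R \<alpha> g B"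
    have pr: "p \<otimes>\<^bsub>?E\<^esub> r = (A \<otimes>\<^bsub>Aut_free R S\<^esub> ?C, g \<otimes>\<^bsub>G\<^esub> h)"
      by (simp add: p r lin_enrichment_def semidirect_product_def GL_f_def)
    then have gh: "g \<otimes>\<^bsub>G\<^esub> h \<in> F" using snd[OF that(3)] by simp
    have A: "A \<in> supported_Aut R S Z" using supp[OF that(1)] by (simp add: p)
    have B: "B \<in> supported_Aut R S Z0" "B \<in> supported_Aut R S Z"
      using supp0[OF that(2)] supp[OF that(2)] by (simp_all add: r)
    have C: "?C \<in> supported_Aut R S Z"
      using supported_Aut_mono[OF \<alpha>.conj_action_supported(1)[OF assms(3) g(2) Z0 B(1)] Z0Z(2)[OF g(1)] \<open>Z \<subseteq> S\<close>] .
    have TA: "tr.T A \<in> carrier (Aut_free R Y)" "tr.T B \<in> carrier (Aut_free R Y)" "tr.T ?C \<in> carrier (Aut_free R Y)"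
      using tr.transport_Aut_closed A B(2) C by blast+
    have conj: "tr.T ?C \<otimes>\<^bsub>Aut_free R Y\<^esub> ?P (\<rho> g) = ?P (\<rho> g) \<otimes>\<^bsub>Aut_free R Y\<^esub> tr.T B"
    proof (rule tr.transport_conj[OF \<alpha>.group_action_axioms g(2) \<beta>.group_action_axioms Q0[OF g(1)] Z0Z(1) Z0Z(2)[OF g(1)] _ B(1)])
      fix x assume "x \<in> Z0"
      then show "\<pi> (\<alpha> g x) = \<beta> (\<rho> g) (\<pi> x)" using eqv[OF g(1), of x] Z0Z(1) Z0Z(2)[OF g(1)] by blast
    qed
    have "\<Psi> (p \<otimes>\<^bsub>?E\<^esub> r) = (tr.T A \<otimes>\<^bsub>Aut_free R Y\<^esub> tr.T ?C) \<otimes>\<^bsub>Aut_free R Y\<^esub> (?P (\<rho> g) \<otimes>\<^bsub>Aut_free R Y\<^esub> ?P (\<rho> h))"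
      by (simp add: pr \<Psi>_def tr.transport_mult[OF A C] \<rho>_mult[OF g(1) h gh] hom_mult[OF P Q0[OF g(1)] Q0[OF h]])
    also have "\<dots> = tr.T A \<otimes>\<^bsub>Aut_free R Y\<^esub> (tr.T ?C \<otimes>\<^bsub>Aut_free R Y\<^esub> ?P (\<rho> g)) \<otimes>\<^bsub>Aut_free R Y\<^esub> ?P (\<rho> h)"
      using TA PY[OF g(1)] PY[OF h] by (simp add: AutY.m_assoc)
    also have "\<dots> = \<Psi> p \<otimes>\<^bsub>Aut_free R Y\<^esub> \<Psi> r"
      unfolding conj using TA PY[OF g(1)] PY[OF h] by (simp add: AutY.m_assoc \<Psi>_def p r)
    finally show ?thesis .
  qed
  have fin\<Psi>: "finite (\<Psi> ` H) \<and> \<Psi> ` H \<subseteq> carrier (Aut_free R Y)" using H(1) \<Psi>_in by blast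
  obtain Q1 :: "nat monoid" and \<phi>1 where Q1: "group Q1" "finite (carrier Q1)"
    and \<phi>1: "\<phi>1 \<in> \<Psi> ` H \<rightarrow> carrier Q1" "inj_on \<phi>1 (\<Psi> ` H)"
      "\<And>a b. a \<in> \<Psi> ` H \<Longrightarrow> b \<in> \<Psi> ` H \<Longrightarrow> a \<otimes>\<^bsub>Aut_free R Y\<^esub> b \<in> \<Psi> ` H \<Longrightarrow>
        \<phi>1 (a \<otimes>\<^bsub>Aut_free R Y\<^esub> b) = \<phi>1 a \<otimes>\<^bsub>Q1\<^esub> \<phi>1 b"
    using Aut[OF Y(1)] fin\<Psi> unfolding LEF_group_def by metis
  obtain Q2 :: "nat monoid" and \<phi>2 where Q2: "group Q2" "finite (carrier Q2)"
    and \<phi>2: "\<phi>2 \<in> F \<rightarrow> carrier Q2" "inj_on \<phi>2 F"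
      "\<And>a b. a \<in> F \<Longrightarrow> b \<in> F \<Longrightarrow> a \<otimes>\<^bsub>G\<^esub> b \<in> F \<Longrightarrow> \<phi>2 (a \<otimes>\<^bsub>G\<^esub> b) = \<phi>2 a \<otimes>\<^bsub>Q2\<^esub> \<phi>2 b"
    using assms(1) F unfolding LEF_group_def by metis
  \<comment> \<open>\<open>\<Psi>\<close> alone need not be injective. Once the second coordinate
    has recovered g, the permutation of \<open>\<rho> g\<close> cancels and injectivity of
    \<open>T\<close> recovers the operator.\<close>
  define \<Phi> where "\<Phi> = (\<lambda>p. (\<phi>1 (\<Psi> p), \<phi>2 (snd p)))"
  have "group (Q1 \<times>\<times> Q2)" using Q1(1) Q2(1) by (rule DirProd_group)
  moreover have "finite (carrier (Q1 \<times>\<times> Q2))" using Q1(2) Q2(2) by (simp add: DirProd_def)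
  moreover have "\<Phi> \<in> H \<rightarrow> carrier (Q1 \<times>\<times> Q2)"
    using \<phi>1(1) \<phi>2(1) snd by (auto simp: \<Phi>_def DirProd_def)
  moreover have "inj_on \<Phi> H"
  proof (rule inj_onI)
    fix p r assume pr: "p \<in> H" "r \<in> H" "\<Phi> p = \<Phi> r"
    have s: "snd p = snd r" using pr inj_onD[OF \<phi>2(2), of "snd p" "snd r"] snd by (simp add: \<Phi>_def)
    have "\<Psi> p = \<Psi> r" using pr inj_onD[OF \<phi>1(2), of "\<Psi> p" "\<Psi> r"] by (simp add: \<Phi>_def)
    then have "tr.T (fst p) \<otimes>\<^bsub>Aut_free R Y\<^esub> ?P (\<rho> (snd p)) = tr.T (fst r) \<otimes>\<^bsub>Aut_free R Y\<^esub> ?P (\<rho> (snd p))"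
      by (simp add: \<Psi>_def case_prod_unfold s)
    then have "tr.T (fst p) = tr.T (fst r)"
      using AutY.r_cancel PY[OF snd[OF pr(1)]] tr.transport_Aut_closed[OF supp[OF pr(1)]]
        tr.transport_Aut_closed[OF supp[OF pr(2)]] by simp
    then have "fst p = fst r" using inj_onD[OF tr.transport_inj] supp pr by blast
    with s show "p = r" by (simp add: prod_eq_iff)
  qed
  moreover have "\<Phi> (p \<otimes>\<^bsub>?E\<^esub> r) = \<Phi> p \<otimes>\<^bsub>Q1 \<times>\<times> Q2\<^esub> \<Phi> r" if pr: "p \<in> H" "r \<in> H" "p \<otimes>\<^bsub>?E\<^esub> r \<in> H" for p r
  proof -
    have s: "snd (p \<otimes>\<^bsub>?E\<^esub> r) = snd p \<otimes>\<^bsub>G\<^esub> snd r"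
      by (simp add: lin_enrichment_def semidirect_product_def case_prod_unfold)
    \<comment> \<open>\<open>\<phi>1\<close> respects only those products that stay in the image of
      \<open>H\<close>; multiplicativity of \<open>\<Psi>\<close> puts this one there.\<close>
    have "\<Psi> p \<otimes>\<^bsub>Aut_free R Y\<^esub> \<Psi> r \<in> \<Psi> ` H" using \<Psi>_mult[OF pr] pr(3) by (metis imageI)
    then have "\<phi>1 (\<Psi> (p \<otimes>\<^bsub>?E\<^esub> r)) = \<phi>1 (\<Psi> p) \<otimes>\<^bsub>Q1\<^esub> \<phi>1 (\<Psi> r)"
      using \<phi>1(3)[of "\<Psi> p" "\<Psi> r"] \<Psi>_mult[OF pr] pr by simp
    moreover have "\<phi>2 (snd (p \<otimes>\<^bsub>?E\<^esub> r)) = \<phi>2 (snd p) \<otimes>\<^bsub>Q2\<^esub> \<phi>2 (snd r)"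
      using \<phi>2(3)[of "snd p" "snd r"] snd[OF pr(1)] snd[OF pr(2)] snd[OF pr(3)] s by simp
    ultimately show ?thesis by (simp add: \<Phi>_def DirProd_def)
  qed
  ultimately show "\<exists>(Q :: (nat \<times> nat) monoid) \<phi>. group Q \<and> finite (carrier Q) \<and>
      \<phi> \<in> H \<rightarrow> carrier Q \<and> inj_on \<phi> H \<and>
      (\<forall>p\<in>H. \<forall>r\<in>H. p \<otimes>\<^bsub>?E\<^esub> r \<in> H \<longrightarrow> \<phi> (p \<otimes>\<^bsub>?E\<^esub> r) = \<phi> p \<otimes>\<^bsub>Q\<^esub> \<phi> r)"
    by (intro exI[of _ "Q1 \<times>\<times> Q2"] exI[of _ \<Phi>]) blast
qed

theorem theorem6p7:
  fixes \<Gamma> :: "('g, 'k) monoid_scheme"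
    and S :: "'x set"
    and \<alpha> :: "'g \<Rightarrow> 'x \<Rightarrow> 'x"
    and R :: "('r, 'm) ring_scheme"
  assumes "LEF_group \<Gamma>"
    and "LEF_action \<Gamma> S \<alpha>"
    and "cring R"
  shows "((\<forall>Z :: nat set. finite Z \<longrightarrow> LEF_group (Aut_free R Z)) \<longrightarrow>
            LEF_group (lin_enrichment \<Gamma> S R \<alpha>)) \<and>
         (domain R \<longrightarrow> LEF_group (lin_enrichment \<Gamma> S R \<alpha>))"
  using LEF_group_lin_enrichment[OF assms] LEF_group_Aut_free_domain by blast

end
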